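(* Let $d\ge k\ge 1$ be integers with $d+k\ge 3$, and let $p\in(0,1)$ be constant. Let $\mathbb{T}_d$ denote the $(d+1)$-regular tree. Starting from the unit mass $\delta_\rho$ at the origin $\rho$ of the product of two regular trees $\mathbb{T}_d\times\mathbb{T}_k$, the minimum number of toppling moves needed to transport mass $p$ to distance at least $n$ from the origin is $$N_p(\mathbb{T}_d\times\mathbb{T}_k,B_n,\delta_\rho)=\theta(d,k)^{n(1+o(1))}\quad\text{as }n\to\infty,\qquad \theta(d,k)=d^{\frac{d-1}{d+k-2}}\cdot k^{\frac{k-1}{d+k-2}},$$ where the $o(1)$ term depends only on $n$, $d$, $k$ and $p$; that is, $\lim_{n\to\infty}\frac1n\log N_p(\mathbb{T}_d\times\mathbb{T}_k,B_n,\delta_\rho)=\log\theta(d,k)$.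
   Context: The Cartesian product $\mathbb{T}_d\times\mathbb{T}_k$ has vertex set $V(\mathbb{T}_d)\times V(\mathbb{T}_k)$, with $(u,v)\sim(u',v')$ iff either $u\sim u'$ and $v=v'$, or $u=u'$ and $v\sim v'$. The origin $\rho$ is an arbitrary fixed vertex (the graph is transitive). Toppling: let $G=(V,E)$ be a connected, locally finite graph, and write $y\sim v$ when $y,v$ are adjacent and $\mathcal{N}_v=\{y:y\sim v\}$. A mass distribution is a function $\mu:V\to[0,\infty)$. For a vertex $v$ with $\mu(v)>0$ and $0<m\le\mu(v)$, the toppling move $T_v^m$ topples mass $m$ at $v$ equally to its neighbours: $T_v^m\mu=\mu-m\delta_v+\frac{m}{|\mathcal{N}_v|}\sum_{y\sim v}\delta_y$. For $A\subset V$, $p>0$ and an initial mass distribution $\mu_0$, $N_p(G,A,\mu_0)$ is the minimum number of successive toppling moves needed to obtain from $\mu_0$ a mass distribution $\mu$ with $\sum_{v\notin A}\mu(v)\ge p$ (and $\infty$ if this is impossible). $B_n=\{u\in V: d_G(u,\rho)<n\}$ is the open ball of radius $n$ around $\rho$ in the graph distance $d_G$. *)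

theory Defs
  imports "HOL-Analysis.Analysis"
begin

text \<open>A simple graph, possibly infinite, is given by its adjacency relation; its vertex set is the
  whole type. In a locally finite graph all neighbourhoods are finite.\<close>

definition simple_graph :: "('a \<Rightarrow> 'a \<Rightarrow> bool) \<Rightarrow> bool" where
  "simple_graph E \<longleftrightarrow> symp E \<and> irreflp E"

definition connected_graph :: "('a \<Rightarrow> 'a \<Rightarrow> bool) \<Rightarrow> bool" where
  "connected_graph E \<longleftrightarrow> (\<forall>u v. E\<^sup>*\<^sup>* u v)"

definition graph_cycle :: "('a \<Rightarrow> 'a \<Rightarrow> bool) \<Rightarrow> 'a list \<Rightarrow> bool" where
  "graph_cycle E xs \<longleftrightarrow>
     3 \<le> length xs \<and> distinct xs \<and> successively E xs \<and> E (last xs) (hd xs)"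

definition is_tree :: "('a \<Rightarrow> 'a \<Rightarrow> bool) \<Rightarrow> bool" where
  "is_tree E \<longleftrightarrow> simple_graph E \<and> connected_graph E \<and> (\<nexists>xs. graph_cycle E xs)"

definition nbrs :: "('a \<Rightarrow> 'a \<Rightarrow> bool) \<Rightarrow> 'a \<Rightarrow> 'a set" where
  "nbrs E v = {y. E y v}"

text \<open>The tree \<open>\<T>\<^sub>d\<close> is indexed by its branching number: every vertex has degree \<open>d + 1\<close>. It is
  unique up to isomorphism, and \<open>regular_tree d E\<close> says that \<open>E\<close> is a copy of it.\<close>

definition regular_tree :: "nat \<Rightarrow> ('a \<Rightarrow> 'a \<Rightarrow> bool) \<Rightarrow> bool" where
  "regular_tree d E \<longleftrightarrow>
     is_tree E \<and> (\<forall>v. finite (nbrs E v) \<and> card (nbrs E v) = d + 1)"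

definition cart_prod ::
    "('a \<Rightarrow> 'a \<Rightarrow> bool) \<Rightarrow> ('b \<Rightarrow> 'b \<Rightarrow> bool) \<Rightarrow> 'a \<times> 'b \<Rightarrow> 'a \<times> 'b \<Rightarrow> bool" where
  "cart_prod E F = (\<lambda>(u, v) (u', v'). (E u u' \<and> v = v') \<or> (u = u' \<and> F v v'))"

text \<open>Length of a shortest walk; meaningful for vertices in the same component.\<close>

definition graph_dist :: "('a \<Rightarrow> 'a \<Rightarrow> bool) \<Rightarrow> 'a \<Rightarrow> 'a \<Rightarrow> nat" where
  "graph_dist E u v = (LEAST t. (E ^^ t) u v)"

definition graph_ball :: "('a \<Rightarrow> 'a \<Rightarrow> bool) \<Rightarrow> 'a \<Rightarrow> nat \<Rightarrow> 'a set" where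
  "graph_ball E r n = {u. graph_dist E u r < n}"

definition point_mass :: "'a \<Rightarrow> 'a \<Rightarrow> real" where
  "point_mass v = indicator {v}"

definition topple :: "('a \<Rightarrow> 'a \<Rightarrow> bool) \<Rightarrow> 'a \<Rightarrow> real \<Rightarrow> ('a \<Rightarrow> real) \<Rightarrow> 'a \<Rightarrow> real" where
  "topple E v m \<mu> =
     (\<lambda>x. \<mu> x - m * point_mass v x
            + m / real (card (nbrs E v)) * (\<Sum>y\<in>nbrs E v. point_mass y x))"

definition topple_step :: "('a \<Rightarrow> 'a \<Rightarrow> bool) \<Rightarrow> ('a \<Rightarrow> real) \<Rightarrow> ('a \<Rightarrow> real) \<Rightarrow> bool" where
  "topple_step E \<mu> \<mu>' \<longleftrightarrow> (\<exists>v m. 0 < \<mu> v \<and> 0 < m \<and> m \<le> \<mu> v \<and> \<mu>' = topple E v m \<mu>)"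

text \<open>Summing in \<^typ>\<open>ennreal\<close> makes the total mass outside \<open>A\<close> meaningful for every
  nonnegative \<open>\<mu>\<close>, including distributions of infinite total mass.\<close>

definition mass_outside :: "'a set \<Rightarrow> ('a \<Rightarrow> real) \<Rightarrow> ennreal" where
  "mass_outside A \<mu> = (\<Sum>\<^sub>\<infinity>v\<in>-A. ennreal (\<mu> v))"

text \<open>The infimum of the empty set in \<^typ>\<open>enat\<close> is \<open>\<infinity>\<close>.\<close>

definition topple_number ::
    "real \<Rightarrow> ('a \<Rightarrow> 'a \<Rightarrow> bool) \<Rightarrow> 'a set \<Rightarrow> ('a \<Rightarrow> real) \<Rightarrow> enat" where
  "topple_number p E A \<mu>\<^sub>0 =
     Inf {enat t | t. \<exists>\<mu>. (topple_step E ^^ t) \<mu>\<^sub>0 \<mu> \<and> ennreal p \<le> mass_outside A \<mu>}"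

definition theta :: "nat \<Rightarrow> nat \<Rightarrow> real" where
  "theta d k =
     real d powr ((real d - 1) / (real d + real k - 2)) *
     real k powr ((real k - 1) / (real d + real k - 2))"

end

theory Submission
  imports Defs
begin

text \<open>Write \<open>\<rho> = (x\<^sub>0, y\<^sub>0)\<close> and let \<open>i\<close>, \<open>j\<close> be the distances of the two coordinates of a vertex
  from \<open>x\<^sub>0\<close>, \<open>y\<^sub>0\<close>. Toppling at a vertex where \<open>f\<close> is superharmonic does not increase the integral
  of \<open>f\<close> against the mass. Simple random walk leaves a large ball of radius \<open>n\<close> with \<open>i\<close> close to
  \<open>s n\<close>, where \<open>s = (d - 1) / (d + k - 2)\<close>, and there are about \<open>\<theta>\<^sup>n\<close> vertices with \<open>i\<close> near \<open>s n\<close>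
  and \<open>j\<close> near \<open>(1 - s) n\<close>. The deviations of \<open>i\<close> are controlled by explicit radial
  superharmonic functions that grow exponentially in one coordinate and decay in the other.

  For the upper bound, topple in polynomially many rounds all vertices of the ball with
  \<open>i \<le> (s + 2 \<epsilon>) n\<close>: the expected distance from \<open>\<rho>\<close> grows with every unit of mass toppled, so
  little mass remains, and little mass leaves the region inside the ball.

  For the lower bound, mass leaves the ball only through the toppled vertices on the sphere of
  radius \<open>n - 1\<close>. Those with small \<open>i\<close> receive little mass, and any other vertex \<open>(a, b)\<close>
  receives at most about \<open>\<theta>\<^sup>-\<^sup>n\<close>, by the superharmonic function with value
  \<open>d\<close> to the power \<open>- dist x a\<close> times \<open>k\<close> to the power \<open>- dist y b\<close> at \<open>(x, y)\<close>.\<close>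

subsection \<open>Superharmonic functions and toppling\<close>

definition avg :: "('a \<Rightarrow> 'a \<Rightarrow> bool) \<Rightarrow> ('a \<Rightarrow> real) \<Rightarrow> 'a \<Rightarrow> real" where
  "avg E f v = (\<Sum>y\<in>nbrs E v. f y) / real (card (nbrs E v))"

text \<open>The sum runs over the support, which is finite for every distribution reached from a
  point mass in a locally finite graph, so no summability questions arise.\<close>

definition tot :: "('a \<Rightarrow> real) \<Rightarrow> ('a \<Rightarrow> real) \<Rightarrow> real" where
  "tot f \<mu> = (\<Sum>v | \<mu> v \<noteq> 0. f v * \<mu> v)"

definition fin_mass :: "('a \<Rightarrow> real) \<Rightarrow> bool" where
  "fin_mass \<mu> \<longleftrightarrow> finite {v. \<mu> v \<noteq> 0} \<and> (\<forall>v. 0 \<le> \<mu> v)"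

lemma tot_eq_sum:
  assumes "finite F" "{v. \<mu> v \<noteq> 0} \<subseteq> F"
  shows "tot f \<mu> = (\<Sum>v\<in>F. f v * \<mu> v)"
  unfolding tot_def using assms by (intro sum.mono_neutral_left) auto

lemma tot_mono:
  assumes "fin_mass \<mu>" "\<And>v. f v \<le> g v"
  shows "tot f \<mu> \<le> tot g \<mu>"
  using assms unfolding tot_def fin_mass_def by (intro sum_mono mult_right_mono) auto

lemma tot_add: "tot (\<lambda>v. f v + g v) \<mu> = tot f \<mu> + tot g \<mu>"
  unfolding tot_def by (simp add: sum.distrib algebra_simps)

lemma tot_nonneg:
  assumes "fin_mass \<mu>" "\<And>v. 0 \<le> f v"
  shows "0 \<le> tot f \<mu>"
  using assms unfolding tot_def fin_mass_def by (intro sum_nonneg) auto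

lemma tot_indicator:
  assumes "fin_mass \<mu>" "finite W"
  shows "tot (indicator W) \<mu> = sum \<mu> W"
proof -
  have "tot (indicator W) \<mu> = (\<Sum>v\<in>W \<union> {v. \<mu> v \<noteq> 0}. indicator W v * \<mu> v)"
    using assms by (intro tot_eq_sum) (auto simp: fin_mass_def)
  also have "\<dots> = (\<Sum>v\<in>W. indicator W v * \<mu> v)"
    using assms by (intro sum.mono_neutral_right) (auto simp: fin_mass_def indicator_def)
  finally show ?thesis by simp
qed

lemma tot_point_mass: "tot f (point_mass v) = f v"
  using tot_eq_sum[of "{v}" "point_mass v" f] by (auto simp: point_mass_def indicator_def)

lemma fin_mass_point_mass: "fin_mass (point_mass v)"
  by (auto simp: fin_mass_def point_mass_def indicator_def)

lemma topple_apply: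
  assumes "finite (nbrs E v)"
  shows "topple E v m \<mu> x =
    \<mu> x - (if x = v then m else 0) + (if x \<in> nbrs E v then m / real (card (nbrs E v)) else 0)"
proof -
  have "(\<Sum>y\<in>nbrs E v. point_mass y x) = (\<Sum>y\<in>nbrs E v. if y = x then 1 else 0)"
    by (intro sum.cong) (auto simp: point_mass_def indicator_def)
  also have "\<dots> = (if x \<in> nbrs E v then 1 else 0)"
    using assms by simp
  finally show ?thesis
    by (simp add: topple_def point_mass_def indicator_def)
qed

lemma topple_zero: "topple E v 0 \<mu> = \<mu>"
  by (simp add: topple_def)

lemma fin_mass_topple:
  assumes "finite (nbrs E v)" "fin_mass \<mu>" "0 \<le> m" "m \<le> \<mu> v"
  shows "fin_mass (topple E v m \<mu>)"
proof -
  have "{x. topple E v m \<mu> x \<noteq> 0} \<subseteq> {x. \<mu> x \<noteq> 0} \<union> {v} \<union> nbrs E v"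
    using assms by (auto simp: topple_apply split: if_splits)
  then have "finite {x. topple E v m \<mu> x \<noteq> 0}"
    using assms by (auto simp: fin_mass_def elim: finite_subset)
  then show ?thesis
    using assms by (auto simp: fin_mass_def topple_apply)
qed

text \<open>Mass \<open>m\<close> at \<open>v\<close> is replaced by the same mass spread over the
  neighbours, so \<open>tot f\<close> changes by \<open>m\<close> times the discrete Laplacian of
  \<open>f\<close> at \<open>v\<close>. In particular it cannot grow where \<open>f\<close> is
  superharmonic.\<close>

lemma tot_topple:
  assumes "finite (nbrs E v)" "fin_mass \<mu>"
  shows "tot f (topple E v m \<mu>) = tot f \<mu> + m * (avg E f v - f v)"
proof -
  define F where "F = {x. \<mu> x \<noteq> 0} \<union> {v} \<union> nbrs E v"
  have F: "finite F" using assms by (auto simp: F_def fin_mass_def)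
  have "tot f (topple E v m \<mu>) = (\<Sum>x\<in>F. f x * topple E v m \<mu> x)"
    using F assms by (intro tot_eq_sum) (auto simp: F_def topple_apply split: if_splits)
  also have "\<dots> = (\<Sum>x\<in>F. f x * \<mu> x - (if x = v then m * f x else 0)
      + (if x \<in> nbrs E v then m / real (card (nbrs E v)) * f x else 0))"
    using assms by (intro sum.cong) (auto simp: topple_apply algebra_simps)
  also have "\<dots> = (\<Sum>x\<in>F. f x * \<mu> x) - (\<Sum>x\<in>F. if x = v then m * f x else 0)
      + (\<Sum>x\<in>F. if x \<in> nbrs E v then m / real (card (nbrs E v)) * f x else 0)"
    by (simp add: sum.distrib sum_subtractf)
  also have "(\<Sum>x\<in>F. if x = v then m * f x else 0) = m * f v"
    using F by (simp add: F_def)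
  also have "(\<Sum>x\<in>F. if x \<in> nbrs E v then m / real (card (nbrs E v)) * f x else 0)
      = (\<Sum>x\<in>nbrs E v. m / real (card (nbrs E v)) * f x)"
    using F by (subst sum.inter_restrict[symmetric]) (auto simp: F_def intro: sum.cong)
  also have "\<dots> = m * avg E f v"
    by (simp add: avg_def sum_distrib_left sum_divide_distrib)
  also have "(\<Sum>x\<in>F. f x * \<mu> x) = tot f \<mu>"
    using F by (intro tot_eq_sum[symmetric]) (auto simp: F_def)
  finally show ?thesis by (simp add: algebra_simps)
qed

lemma mass_outside_eq_tot:
  assumes "fin_mass \<mu>"
  shows "mass_outside A \<mu> = ennreal (tot (indicator (- A)) \<mu>)"
proof -
  let ?F = "{v. \<mu> v \<noteq> 0} \<inter> - A"
  have F: "finite ?F" using assms by (simp add: fin_mass_def)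
  have "mass_outside A \<mu> = (\<Sum>\<^sub>\<infinity>v\<in>?F. ennreal (\<mu> v))"
    unfolding mass_outside_def by (intro infsum_cong_neutral) auto
  also have "\<dots> = (\<Sum>v\<in>?F. ennreal (\<mu> v))"
    using F by simp
  also have "\<dots> = ennreal (\<Sum>v\<in>?F. \<mu> v)"
    using assms by (intro sum_ennreal) (auto simp: fin_mass_def)
  also have "(\<Sum>v\<in>?F. \<mu> v) = (\<Sum>v\<in>?F. indicator (- A) v * \<mu> v)"
    by (intro sum.cong) auto
  also have "\<dots> = tot (indicator (- A)) \<mu>"
    unfolding tot_def using assms by (intro sum.mono_neutral_left) (auto simp: fin_mass_def)
  finally show ?thesis .
qed

text \<open>\<open>A\<close> collects the toppled vertices, at most one new one per move. As
  \<open>f\<close> is quantified after \<open>A\<close>, the test function may depend on which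
  vertices were toppled.\<close>

lemma topple_steps_superharmonic:
  assumes fin: "\<And>v. finite (nbrs E v)"
    and "fin_mass \<mu>\<^sub>0" "(topple_step E ^^ t) \<mu>\<^sub>0 \<mu>"
  shows "fin_mass \<mu> \<and> (\<exists>A. finite A \<and> card A \<le> t \<and>
    (\<forall>f. (\<forall>v\<in>A. avg E f v \<le> f v) \<longrightarrow> tot f \<mu> \<le> tot f \<mu>\<^sub>0))"
  using assms(3)
proof (induction t arbitrary: \<mu>)
  case 0
  then show ?case using assms(2) by (auto intro!: exI[of _ "{}"])
next
  case (Suc t)
  then obtain \<nu> where \<nu>: "(topple_step E ^^ t) \<mu>\<^sub>0 \<nu>" "topple_step E \<nu> \<mu>" by auto
  then obtain A where A: "fin_mass \<nu>" "finite A" "card A \<le> t"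
    "\<And>f. (\<forall>v\<in>A. avg E f v \<le> f v) \<Longrightarrow> tot f \<nu> \<le> tot f \<mu>\<^sub>0"
    using Suc.IH[of \<nu>] by blast
  obtain v m where vm: "0 < m" "m \<le> \<nu> v" "\<mu> = topple E v m \<nu>"
    using \<nu>(2) by (auto simp: topple_step_def)
  have "tot f \<mu> \<le> tot f \<mu>\<^sub>0" if "\<forall>v\<in>insert v A. avg E f v \<le> f v" for f
  proof -
    have "m * (avg E f v - f v) \<le> 0"
      using that vm by (intro mult_nonneg_nonpos) auto
    then show ?thesis
      using that A(4)[of f] by (simp add: vm tot_topple[OF fin A(1)])
  qed
  moreover have "finite (insert v A)" "card (insert v A) \<le> Suc t"
    using A by (auto simp: card_insert_if)
  ultimately show ?case
    using fin_mass_topple[OF fin A(1)] vm by (metis less_imp_le)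
qed

text \<open>The tool for lower bounds: at the end \<open>tot f\<close> is at least the mass outside
  \<open>A\<close>, at the beginning it is the value of \<open>f\<close> at the origin. The number
  \<open>t\<close> enters only through the size of \<open>B\<close>.\<close>

lemma topple_number_superharmonic:
  assumes fin: "\<And>v. finite (nbrs E v)"
    and N: "topple_number p E A (point_mass \<rho>) = enat t"
  shows "\<exists>B. finite B \<and> card B \<le> t \<and>
    (\<forall>f. (\<forall>v\<in>B. avg E f v \<le> f v) \<longrightarrow> (\<forall>v. 0 \<le> f v) \<longrightarrow> (\<forall>v. v \<notin> A \<longrightarrow> 1 \<le> f v) \<longrightarrow> p \<le> f \<rho>)"
proof -
  define X where
    "X = {enat t | t. \<exists>\<mu>. (topple_step E ^^ t) (point_mass \<rho>) \<mu> \<and> ennreal p \<le> mass_outside A \<mu>}"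
  have Inf: "Inf X = enat t"
    using N by (simp add: topple_number_def X_def)
  then have "X \<noteq> {}"
    by (auto simp: Inf_enat_def)
  then obtain s where "s \<in> X" by blast
  \<comment> \<open>\<open>enat\<close> is well-ordered, so the infimum is attained by an actual
    sequence of moves.\<close>
  then have "enat t \<in> X"
    unfolding Inf[symmetric] by (rule wellorder_InfI)
  then obtain \<mu> where \<mu>: "(topple_step E ^^ t) (point_mass \<rho>) \<mu>" "ennreal p \<le> mass_outside A \<mu>"
    unfolding X_def by auto
  obtain B where B: "fin_mass \<mu>" "finite B" "card B \<le> t"
    "\<And>f. (\<forall>v\<in>B. avg E f v \<le> f v) \<Longrightarrow> tot f \<mu> \<le> tot f (point_mass \<rho>)"
    using topple_steps_superharmonic[OF fin fin_mass_point_mass \<mu>(1)] by blast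
  have "p \<le> f \<rho>" if "\<forall>v\<in>B. avg E f v \<le> f v" "\<forall>v. 0 \<le> f v" "\<forall>v. v \<notin> A \<longrightarrow> 1 \<le> f v" for f
  proof -
    have "p \<le> tot (indicator (- A)) \<mu>"
      using \<mu>(2) tot_nonneg[OF B(1), of "indicator (- A)"]
      by (simp add: mass_outside_eq_tot[OF B(1)])
    also have "\<dots> \<le> tot f \<mu>"
      using that by (intro tot_mono[OF B(1)]) (auto simp: indicator_def)
    also have "\<dots> \<le> f \<rho>"
      using B(4)[of f] that(1) by (simp add: tot_point_mass)
    finally show ?thesis .
  qed
  then show ?thesis using B by blast
qed

section \<open>Emptying a set of vertices in rounds\<close>

definition reach :: "('a \<Rightarrow> 'a \<Rightarrow> bool) \<Rightarrow> nat \<Rightarrow> ('a \<Rightarrow> real) \<Rightarrow> ('a \<Rightarrow> real) \<Rightarrow> bool" where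
  "reach E t \<mu> \<nu> \<longleftrightarrow> (\<exists>s\<le>t. (topple_step E ^^ s) \<mu> \<nu>)"

lemma reach_refl: "reach E 0 \<mu> \<mu>"
  by (simp add: reach_def)

lemma reach_trans: "reach E s \<mu> \<nu> \<Longrightarrow> reach E t \<nu> \<kappa> \<Longrightarrow> reach E (s + t) \<mu> \<kappa>"
  unfolding reach_def by (metis add_mono relpowp_add relcomppI)

lemma reach_mono: "reach E s \<mu> \<nu> \<Longrightarrow> s \<le> t \<Longrightarrow> reach E t \<mu> \<nu>"
  unfolding reach_def by (meson le_trans)

lemma reach_full_topple:
  assumes "fin_mass \<mu>"
  shows "reach E 1 \<mu> (topple E v (\<mu> v) \<mu>)"
proof (cases "\<mu> v = 0")
  case True
  \<comment> \<open>Toppling mass 0 is not a legal move. An empty vertex is skipped instead, which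
    is why \<open>reach\<close> allows fewer than \<open>t\<close> moves.\<close>
  then show ?thesis using reach_mono[OF reach_refl] by (simp add: topple_zero)
next
  case False
  then have "0 < \<mu> v" using assms by (auto simp: fin_mass_def less_le)
  then have "topple_step E \<mu> (topple E v (\<mu> v) \<mu>)" by (auto simp: topple_step_def)
  then show ?thesis unfolding reach_def by (intro exI[of _ 1]) (simp add: eq_OO)
qed

text \<open>Topplings are sequential, so a vertex is emptied of at least the mass which it carried at the
  beginning of the round.\<close>

lemma topple_round:
  assumes fin: "\<And>v. finite (nbrs E v)" and "finite W" and "fin_mass \<mu>"
  shows "\<exists>\<nu>. fin_mass \<nu> \<and> reach E (card W) \<mu> \<nu> \<and>
    (\<forall>f l. 0 \<le> l \<longrightarrow> (\<forall>v\<in>W. avg E f v \<le> f v - l) \<longrightarrow> tot f \<nu> \<le> tot f \<mu> - l * sum \<mu> W)"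
  using assms(2,3)
proof (induction W arbitrary: \<mu> rule: finite_induct)
  case empty
  then show ?case using reach_refl by fastforce
next
  case (insert v W)
  define \<kappa> where "\<kappa> = topple E v (\<mu> v) \<mu>"
  have \<kappa>: "fin_mass \<kappa>"
    unfolding \<kappa>_def using insert.prems by (intro fin_mass_topple fin) (auto simp: fin_mass_def)
  obtain \<nu> where \<nu>: "fin_mass \<nu>" "reach E (card W) \<kappa> \<nu>"
    "\<And>f l. 0 \<le> l \<Longrightarrow> (\<forall>v\<in>W. avg E f v \<le> f v - l) \<Longrightarrow> tot f \<nu> \<le> tot f \<kappa> - l * sum \<kappa> W"
    using insert.IH[OF \<kappa>] by blast
  have "reach E (1 + card W) \<mu> \<nu>"
    using reach_full_topple[OF insert.prems, of E v] \<nu>(2) unfolding \<kappa>_def by (rule reach_trans)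
  then have "reach E (card (insert v W)) \<mu> \<nu>" using insert by simp
  moreover have "tot f \<nu> \<le> tot f \<mu> - l * sum \<mu> (insert v W)"
    if "0 \<le> l" "\<forall>v\<in>insert v W. avg E f v \<le> f v - l" for f l
  proof -
    have "sum \<mu> W \<le> sum \<kappa> W"
      using insert.hyps insert.prems
      by (intro sum_mono) (auto simp: \<kappa>_def topple_apply[OF fin] fin_mass_def)
    then have "l * sum \<mu> W \<le> l * sum \<kappa> W" using that by (intro mult_left_mono)
    moreover have "\<mu> v * (avg E f v - f v) \<le> \<mu> v * (- l)"
      using that insert.prems by (intro mult_left_mono) (auto simp: fin_mass_def)
    moreover have "tot f \<kappa> = tot f \<mu> + \<mu> v * (avg E f v - f v)"
      unfolding \<kappa>_def using tot_topple[OF fin insert.prems] .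
    moreover have "tot f \<nu> \<le> tot f \<kappa> - l * sum \<kappa> W" using \<nu>(3) that by auto
    ultimately show ?thesis using insert by (simp add: algebra_simps)
  qed
  ultimately show ?case using \<nu>(1) by blast
qed

text \<open>The nonnegative potential \<open>g\<close> is a budget: a round that starts with mass
  more than \<open>c\<close> on \<open>W\<close> uses up at least \<open>l * c\<close> of it. So
  after at most \<open>t\<close> rounds the mass left on \<open>W\<close> is at most
  \<open>c\<close>.\<close>

lemma topple_rounds:
  assumes fin: "\<And>v. finite (nbrs E v)" and "finite W" and "fin_mass \<mu>"
    and g: "\<And>v. 0 \<le> g v" and l: "0 < l" "\<And>v. v \<in> W \<Longrightarrow> avg E g v \<le> g v - l"
    and c: "0 \<le> c" and big: "tot g \<mu> \<le> l * c * real t"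
  shows "\<exists>\<nu>. fin_mass \<nu> \<and> reach E (t * card W) \<mu> \<nu> \<and> sum \<nu> W \<le> c \<and>
    (\<forall>f. (\<forall>v\<in>W. avg E f v \<le> f v) \<longrightarrow> tot f \<nu> \<le> tot f \<mu>)"
  using assms(3) big
proof (induction t arbitrary: \<mu>)
  case 0
  \<comment> \<open>With the budget exhausted, one more round is only imagined: it could not lower
    \<open>tot g\<close> any further, so \<open>W\<close> carries no mass.\<close>
  then obtain \<nu> where \<nu>: "tot g \<nu> \<le> tot g \<mu> - l * sum \<mu> W" "fin_mass \<nu>"
    using topple_round[OF fin \<open>finite W\<close> 0(1)] l by (meson less_imp_le)
  have "l * sum \<mu> W \<le> 0" using \<nu>(1) tot_nonneg[of \<nu> g, OF \<nu>(2) g] 0(2) by simp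
  then have "sum \<mu> W \<le> c" using l c by (simp add: mult_le_0_iff)
  then show ?case using 0 reach_refl by fastforce
next
  case (Suc t)
  show ?case
  proof (cases "sum \<mu> W \<le> c")
    case True
    then show ?thesis using Suc.prems reach_mono[OF reach_refl] by blast
  next
    case False
    obtain \<kappa> where \<kappa>: "fin_mass \<kappa>" "reach E (card W) \<mu> \<kappa>"
      "\<And>f l. 0 \<le> l \<Longrightarrow> (\<forall>v\<in>W. avg E f v \<le> f v - l) \<Longrightarrow> tot f \<kappa> \<le> tot f \<mu> - l * sum \<mu> W"
      using topple_round[OF fin \<open>finite W\<close> Suc.prems(1)] by blast
    have "tot g \<kappa> \<le> tot g \<mu> - l * sum \<mu> W" using \<kappa>(3) l by auto
    also have "\<dots> \<le> tot g \<mu> - l * c" using l False by simp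
    also have "\<dots> \<le> l * c * real t" using Suc.prems(2) by (simp add: algebra_simps)
    finally obtain \<nu> where \<nu>: "fin_mass \<nu>" "reach E (t * card W) \<kappa> \<nu>" "sum \<nu> W \<le> c"
      "\<And>f. (\<forall>v\<in>W. avg E f v \<le> f v) \<Longrightarrow> tot f \<nu> \<le> tot f \<kappa>"
      using Suc.IH[OF \<kappa>(1)] by blast
    have "tot f \<nu> \<le> tot f \<mu>" if "\<forall>v\<in>W. avg E f v \<le> f v" for f
      using \<nu>(4)[OF that] \<kappa>(3)[of 0 f] that by simp
    then show ?thesis using \<nu> reach_trans[OF \<kappa>(2) \<nu>(2)] by auto
  qed
qed

text \<open>The unit mass ends up in three places: on \<open>W\<close>, where at most
  \<open>c\<close> remains; in \<open>A\<close> outside \<open>W\<close>, where \<open>f\<close> is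
  at least 1 and the mass is therefore at most the value of \<open>f\<close> at the origin; and
  outside \<open>A\<close>, which gets the rest.\<close>

lemma topple_number_le:
  assumes fin: "\<And>v. finite (nbrs E v)" "\<And>v. nbrs E v \<noteq> {}" and "finite W"
    and g: "\<And>v. 0 \<le> g v" and l: "0 < l" "\<And>v. v \<in> W \<Longrightarrow> avg E g v \<le> g v - l"
    and f: "\<And>v. 0 \<le> f v" "\<And>v. v \<in> W \<Longrightarrow> avg E f v \<le> f v"
      "\<And>v. v \<in> A \<Longrightarrow> v \<notin> W \<Longrightarrow> 1 \<le> f v"
    and c: "0 \<le> c" "g \<rho> \<le> l * c * real t" "c + f \<rho> \<le> 1 - p"
  shows "topple_number p E A (point_mass \<rho>) \<le> enat (t * card W)"
proof -
  obtain \<nu> where \<nu>: "fin_mass \<nu>" "reach E (t * card W) (point_mass \<rho>) \<nu>" "sum \<nu> W \<le> c"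
      "\<And>f. (\<forall>v\<in>W. avg E f v \<le> f v) \<Longrightarrow> tot f \<nu> \<le> tot f (point_mass \<rho>)"
    using topple_rounds[OF fin(1) \<open>finite W\<close> fin_mass_point_mass g l c(1), of \<rho> t] c(2)
    by (auto simp: tot_point_mass)
  \<comment> \<open>The constant -1 is harmonic, so its integral does not increase: no mass is
    lost.\<close>
  have "tot (\<lambda>_. - 1) \<nu> \<le> tot (\<lambda>_. - 1) (point_mass \<rho>)"
    using fin by (intro \<nu>(4)) (auto simp: avg_def card_eq_0_iff field_simps)
  then have "1 \<le> tot (\<lambda>_. 1) \<nu>"
    unfolding tot_point_mass by (simp add: tot_def sum_negf)
  also have "\<dots> \<le> tot (\<lambda>v. (indicator W v + f v) + indicator (- A) v) \<nu>"
  proof (rule tot_mono[OF \<nu>(1)])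
    show "1 \<le> (indicator W v + f v) + indicator (- A) v" for v
      using f(1)[of v] f(3)[of v] by (auto simp: indicator_def)
  qed
  also have "\<dots> = sum \<nu> W + tot f \<nu> + tot (indicator (- A)) \<nu>"
    by (simp add: tot_add tot_indicator[OF \<nu>(1) \<open>finite W\<close>])
  also have "tot f \<nu> \<le> f \<rho>" using \<nu>(4)[of f] f by (simp add: tot_point_mass)
  finally have "p \<le> tot (indicator (- A)) \<nu>" using \<nu>(3) c by simp
  then have p: "ennreal p \<le> mass_outside A \<nu>"
    by (simp add: mass_outside_eq_tot[OF \<nu>(1)] ennreal_leI)
  obtain s where "s \<le> t * card W" "(topple_step E ^^ s) (point_mass \<rho>) \<nu>"
    using \<nu>(2) by (auto simp: reach_def)
  then have "topple_number p E A (point_mass \<rho>) \<le> enat s"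
    unfolding topple_number_def using p by (intro Inf_lower) blast
  also have "\<dots> \<le> enat (t * card W)" using \<open>s \<le> _\<close> by simp
  finally show ?thesis .
qed

subsection \<open>Distances in regular trees\<close>

lemma relpowp_sym:
  assumes "symp E" "(E ^^ t) u v"
  shows "(E ^^ t) v u"
  using assms(2)
proof (induction t arbitrary: v)
  case (Suc t)
  then obtain w where "(E ^^ t) u w" "E w v" by auto
  then show ?case
    using Suc.IH[of w] assms(1) relpowp_Suc_I2[of E v w t u] by (auto dest: sympD)
qed simp

locale conn_graph =
  fixes E :: "'a \<Rightarrow> 'a \<Rightarrow> bool"
  assumes sym: "symp E" and irr: "irreflp E" and conn: "connected_graph E"
begin

lemma symD: "E x y \<Longrightarrow> E y x"
  using sym by (rule sympD)

lemma irreflD: "\<not> E x x"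
  using irr by (rule irreflpD)

lemma dist_walk: "(E ^^ graph_dist E u v) u v"
  using conn unfolding connected_graph_def graph_dist_def
  by (metis LeastI_ex rtranclp_power)

lemma dist_le: "(E ^^ t) u v \<Longrightarrow> graph_dist E u v \<le> t"
  unfolding graph_dist_def by (rule Least_le)

lemma dist_self [simp]: "graph_dist E u u = 0"
  using dist_le[of 0 u u] by simp

lemma dist_eq_0_iff [simp]: "graph_dist E u v = 0 \<longleftrightarrow> u = v"
  using dist_walk[of u v] by (metis dist_self relpowp_0_E)

lemma dist_commute: "graph_dist E u v = graph_dist E v u"
  using dist_walk dist_le relpowp_sym[OF sym] by (metis le_antisym)

lemma dist_step: "E x y \<Longrightarrow> graph_dist E x r \<le> Suc (graph_dist E y r)"
  using dist_walk[of y r] by (intro dist_le) (rule relpowp_Suc_I2)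

lemma dist_parent:
  assumes "graph_dist E x r = Suc D"
  obtains y where "E x y" "graph_dist E y r = D"
proof -
  obtain y where y: "E x y" "(E ^^ D) y r"
    using dist_walk[of x r] assms by (metis relpowp_Suc_D2)
  then have "graph_dist E y r \<le> D" by (intro dist_le)
  moreover have "Suc D \<le> Suc (graph_dist E y r)"
    using dist_step[OF y(1), of r] assms by simp
  ultimately show ?thesis using that y(1) by (metis Suc_le_mono le_antisym)
qed

end

text \<open>Loop erasure: if the new first vertex already lies on the path, everything before that
  occurrence is cut off.\<close>

lemma rtranclp_imp_distinct_path:
  assumes "R\<^sup>*\<^sup>* y z"
  shows "\<exists>xs. xs \<noteq> [] \<and> hd xs = y \<and> last xs = z \<and> successively R xs \<and> distinct xs"
  using assms
proof (induction rule: converse_rtranclp_induct)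
  case base
  show ?case by (intro exI[of _ "[z]"]) simp
next
  case (step y w)
  then obtain xs where xs: "xs \<noteq> []" "hd xs = w" "last xs = z" "successively R xs" "distinct xs"
    by blast
  show ?case
  proof (cases "y \<in> set xs")
    case True
    then obtain as bs where "xs = as @ y # bs" by (meson split_list)
    then show ?thesis using xs
      by (intro exI[of _ "y # bs"]) (auto simp: successively_append_iff)
  next
    case False
    then show ?thesis using xs step(1)
      by (intro exI[of _ "y # xs"]) (auto simp: successively_Cons)
  qed
qed

locale reg_tree = conn_graph E for E :: "'a \<Rightarrow> 'a \<Rightarrow> bool" +
  fixes d :: nat
  assumes acyclic: "\<nexists>xs. graph_cycle E xs"
    and fin_nbrs: "finite (nbrs E v)" and card_nbrs: "card (nbrs E v) = d + 1"

lemma reg_tree_iff: "regular_tree d E \<longleftrightarrow> reg_tree E d"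
  unfolding regular_tree_def is_tree_def simple_graph_def reg_tree_def reg_tree_axioms_def
    conn_graph_def by auto

context reg_tree
begin

text \<open>A geodesic from \<open>y\<close> to \<open>r\<close> has distance less than
  \<open>D\<close> from \<open>r\<close> after its first vertex, so it cannot meet
  \<open>x\<close>.\<close>

lemma walk_to_root_avoiding:
  "graph_dist E y r \<le> D \<Longrightarrow> graph_dist E x r \<ge> D \<Longrightarrow> y \<noteq> x \<Longrightarrow>
    (\<lambda>u v. E u v \<and> u \<noteq> x \<and> v \<noteq> x)\<^sup>*\<^sup>* y r"
proof (induction D arbitrary: y)
  case (Suc D)
  show ?case
  proof (cases "graph_dist E y r = Suc D")
    case True
    then obtain w where w: "E y w" "graph_dist E w r = D" by (rule dist_parent)
    then have "w \<noteq> x" using Suc.prems by auto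
    then show ?thesis
      using Suc.IH[of w] w Suc.prems by (auto intro: converse_rtranclp_into_rtranclp)
  next
    case False
    then show ?thesis using Suc by auto
  qed
qed simp

text \<open>Two such neighbours would be joined to \<open>r\<close>, hence to each other, by walks avoiding \<open>x\<close>, which
  closes a cycle through \<open>x\<close>.\<close>

lemma unique_parent:
  assumes "E x y" "E x z" "graph_dist E y r \<le> graph_dist E x r" "graph_dist E z r \<le> graph_dist E x r"
  shows "y = z"
proof (rule ccontr)
  assume "y \<noteq> z"
  let ?R = "\<lambda>u v. E u v \<and> u \<noteq> x \<and> v \<noteq> x"
  have "y \<noteq> x" "z \<noteq> x" using assms irreflD by auto
  then have "?R\<^sup>*\<^sup>* y r" "?R\<^sup>*\<^sup>* z r"
    using walk_to_root_avoiding[OF assms(3) order_refl] walk_to_root_avoiding[OF assms(4) order_refl] by simp_all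
  moreover have "symp (?R\<^sup>*\<^sup>*)" using symD by (intro symp_rtranclp sympI) auto
  ultimately have "?R\<^sup>*\<^sup>* y z"
    by (blast dest: sympD intro: rtranclp_trans)
  from rtranclp_imp_distinct_path[OF this]
  obtain xs where xs: "xs \<noteq> []" "hd xs = y" "last xs = z" "successively ?R xs" "distinct xs"
    by (elim exE conjE)
  \<comment> \<open>As \<open>y\<close> and \<open>z\<close> differ, the path has at least two
    vertices. So each of them is an end of an edge avoiding \<open>x\<close>, and together with
    \<open>x\<close> there are the three vertices that a cycle needs.\<close>
  obtain w ws where ws: "xs = y # w # ws"
    using xs \<open>y \<noteq> z\<close> by (cases xs; cases "tl xs") auto
  have "x \<notin> set xs"
    using xs(4) unfolding ws
  proof (induction ws arbitrary: y w)
    case (Cons a ws)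
    have "x \<notin> set (w # a # ws)" using Cons.prems by (intro Cons.IH) simp
    then show ?case using Cons.prems by auto
  qed auto
  moreover have "successively E xs" using xs(4) by (rule successively_mono) auto
  ultimately have "graph_cycle E (x # xs)"
    using xs assms ws symD by (auto simp: graph_cycle_def)
  then show False using acyclic by blast
qed

lemma nbrs_root: "y \<in> nbrs E r \<Longrightarrow> graph_dist E y r = 1"
  using dist_step[of y r r] irreflD by (cases "y = r") (auto simp: nbrs_def le_Suc_eq)

text \<open>\<open>unique_parent\<close> also rules out a second neighbour at the same distance as
  \<open>x\<close>, so every neighbour except the parent lies strictly farther from
  \<open>r\<close>.\<close>

lemma nbrs_split:
  assumes "graph_dist E x r = Suc D"
  obtains y where "y \<in> nbrs E x" "graph_dist E y r = D"
    "\<And>z. z \<in> nbrs E x - {y} \<Longrightarrow> graph_dist E z r = Suc (Suc D)"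
proof -
  obtain y where y: "E x y" "graph_dist E y r = D" using assms by (rule dist_parent)
  have "graph_dist E z r = Suc (Suc D)" if z: "E z x" "z \<noteq> y" for z
  proof -
    have "\<not> graph_dist E z r \<le> Suc D"
      using unique_parent[of x y z r] y z assms symD by auto
    moreover have "graph_dist E z r \<le> Suc (Suc D)" using dist_step[OF z(1), of r] assms by simp
    ultimately show ?thesis by simp
  qed
  then show ?thesis using that[of y] y symD by (auto simp: nbrs_def)
qed

lemma sum_nbrs_dist:
  fixes g :: "nat \<Rightarrow> real"
  shows "(\<Sum>y\<in>nbrs E x. g (graph_dist E y r)) =
    (case graph_dist E x r of 0 \<Rightarrow> (real d + 1) * g 1 | Suc D \<Rightarrow> g D + real d * g (Suc (Suc D)))"
proof (cases "graph_dist E x r")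
  case 0
  then have "(\<Sum>y\<in>nbrs E x. g (graph_dist E y r)) = (\<Sum>y\<in>nbrs E x. g 1)"
    using nbrs_root by (intro sum.cong) auto
  then show ?thesis using 0 card_nbrs by simp
next
  case (Suc D)
  then obtain y where y: "y \<in> nbrs E x" "graph_dist E y r = D"
    "\<And>z. z \<in> nbrs E x - {y} \<Longrightarrow> graph_dist E z r = Suc (Suc D)" using nbrs_split by blast
  have "(\<Sum>y\<in>nbrs E x. g (graph_dist E y r)) =
      g D + (\<Sum>z\<in>nbrs E x - {y}. g (graph_dist E z r))"
    using y fin_nbrs by (simp add: sum.remove)
  also have "(\<Sum>z\<in>nbrs E x - {y}. g (graph_dist E z r)) = (\<Sum>z\<in>nbrs E x - {y}. g (Suc (Suc D)))"
    using y by (intro sum.cong) auto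
  also have "\<dots> = real d * g (Suc (Suc D))"
    using y card_nbrs fin_nbrs by (simp add: card_Diff_singleton)
  finally show ?thesis using Suc by simp
qed

text \<open>For positive \<open>i\<close> the bound exceeds the true size by a factor
  \<open>d\<close>; in exchange it holds at \<open>i = 0\<close> as well. The first sphere is
  treated apart because the root has \<open>d + 1\<close> children instead of
  \<open>d\<close>.\<close>

lemma finite_card_sphere:
  assumes "d \<ge> 1"
  shows "finite {x. graph_dist E x r = i} \<and> card {x. graph_dist E x r = i} \<le> (d + 1) * d ^ i"
proof (induction i)
  case 0
  then show ?case by simp
next
  case (Suc i)
  let ?S = "\<lambda>i. {x. graph_dist E x r = i}"
  define C where "C x = {y \<in> nbrs E x. graph_dist E y r = Suc i}" for x
  have sub: "?S (Suc i) \<subseteq> (\<Union>x\<in>?S i. C x)"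
  proof
    fix y assume "y \<in> ?S (Suc i)"
    then show "y \<in> (\<Union>x\<in>?S i. C x)"
      using dist_parent[of y r i] by (auto simp: C_def nbrs_def)
  qed
  have finC: "finite (C x)" for x unfolding C_def using fin_nbrs by auto
  have fin: "finite (?S (Suc i))"
    using sub by (rule finite_subset) (use Suc finC in auto)
  show ?case
  proof (cases i)
    case 0
    have "?S 1 \<subseteq> nbrs E r"
    proof
      fix y assume "y \<in> ?S 1"
      then show "y \<in> nbrs E r"
        using dist_parent[of y r 0] by (auto simp: nbrs_def)
    qed
    then have "card (?S 1) \<le> d + 1" using card_mono[OF fin_nbrs] card_nbrs by metis
    also have "\<dots> \<le> (d + 1) * d ^ Suc i" using assms 0 by simp
    finally show ?thesis using fin 0 by simp
  next
    case (Suc j)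
    have "card (C x) \<le> d" if "x \<in> ?S i" for x
    proof -
      obtain y where y: "y \<in> nbrs E x" "graph_dist E y r = j"
        using nbrs_split[of x r j] \<open>x \<in> ?S i\<close> Suc by auto
      have "C x \<subseteq> nbrs E x - {y}" using y Suc by (auto simp: C_def)
      then have "card (C x) \<le> card (nbrs E x - {y})" using fin_nbrs by (intro card_mono) auto
      then show ?thesis using y card_nbrs fin_nbrs by (simp add: card_Diff_singleton)
    qed
    then have "(\<Sum>x\<in>?S i. card (C x)) \<le> card (?S i) * d"
      using sum_bounded_above[of "?S i" "\<lambda>x. card (C x)" d] by simp
    moreover have "card (?S (Suc i)) \<le> card (\<Union>x\<in>?S i. C x)"
      using sub Suc.IH finC by (intro card_mono) auto
    moreover have "card (\<Union>x\<in>?S i. C x) \<le> (\<Sum>x\<in>?S i. card (C x))"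
      using Suc.IH by (intro card_UN_le) auto
    moreover have "card (?S i) * d \<le> (d + 1) * d ^ i * d" using Suc.IH by (intro mult_right_mono) auto
    moreover have "(d + 1) * d ^ i * d = (d + 1) * d ^ Suc i" by (simp add: algebra_simps)
    ultimately show ?thesis using fin by linarith
  qed
qed

end

subsection \<open>Radial potentials on a product of two trees\<close>

text \<open>By \<open>sum_nbrs_dist\<close>, this is the adjacency operator of the tree on radial
  functions. It is neither normalised nor centred, so that on a product the eigenvalues of the two
  factors simply add.\<close>

definition radial_laplace :: "nat \<Rightarrow> (nat \<Rightarrow> real) \<Rightarrow> nat \<Rightarrow> real" where
  "radial_laplace d g i =
    (case i of 0 \<Rightarrow> (real d + 1) * g 1 | Suc D \<Rightarrow> g D + real d * g (Suc (Suc D)))"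

text \<open>Away from the root this is an equality: the parent contributes \<open>d\<close> times
  the value and the \<open>d\<close> children together contribute once the value. For
  \<open>d\<close> at least 2 the function is a multiple of the Green function of simple random
  walk.\<close>

lemma radial_laplace_green:
  assumes "d \<ge> 1"
  shows "radial_laplace d (\<lambda>i. (1 / real d) ^ i) i \<le> (real d + 1) * (1 / real d) ^ i"
proof (cases i)
  case 0
  have "1 / real d \<le> 1" using assms by simp
  then have "(real d + 1) * (1 / real d) \<le> (real d + 1) * 1" by (intro mult_left_mono) auto
  then show ?thesis using 0 by (simp add: radial_laplace_def)
next
  case (Suc D)
  then show ?thesis using assms by (simp add: radial_laplace_def field_simps)
qed

text \<open>An eigenfunction away from the root; at the root the inequality comes from s being at
  most 1/s.\<close>

lemma radial_laplace_decay:
  assumes "0 < s" "s \<le> 1"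
  shows "radial_laplace d (\<lambda>i. s ^ i) i \<le> (real d * s + 1 / s) * s ^ i"
proof (cases i)
  case 0
  have "s * s \<le> 1" using assms by (simp add: mult_le_one)
  then have "s \<le> 1 / s" using assms by (simp add: field_simps)
  then show ?thesis using 0 by (simp add: radial_laplace_def algebra_simps)
next
  case (Suc D)
  then show ?thesis using assms by (simp add: radial_laplace_def field_simps)
qed

text \<open>The powers of \<open>r\<close> alone are not superharmonic at the root. The powers of \<open>1 / (k r)\<close> belong to the
  same eigenvalue and repair this.\<close>

lemma radial_laplace_growth:
  assumes "0 < r" "k \<ge> 1"
  shows "radial_laplace k (\<lambda>j. r ^ j + (1 / (real k * r)) ^ j) j
    \<le> (real k * r + 1 / r) * (r ^ j + (1 / (real k * r)) ^ j)"
proof (cases j)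
  case 0
  \<comment> \<open>With q = 1/(k r), the claim at the root reads (k + 1)(r + q) <= 2 k (r +
    q).\<close>
  have "1 * (r + 1 / (real k * r)) \<le> real k * (r + 1 / (real k * r))"
    using assms by (intro mult_right_mono) (auto simp: add_nonneg_nonneg)
  moreover have "real k * r + 1 / r = real k * (r + 1 / (real k * r))"
    using assms by (simp add: field_simps)
  ultimately show ?thesis
    using 0 by (simp add: radial_laplace_def distrib_right)
next
  case (Suc D)
  define q where "q = 1 / (real k * r)"
  have q: "real k * q = 1 / r" "1 / q = real k * r" "q > 0"
    using assms by (auto simp: q_def)
  have "(real k * r + 1 / r) * q ^ Suc D = (1 / q + real k * q) * q ^ Suc D"
    using q by simp
  also have "\<dots> = q ^ D + real k * q ^ Suc (Suc D)"
    using q(3) by (simp add: field_simps)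
  finally have "(real k * r + 1 / r) * q ^ Suc D = q ^ D + real k * q ^ Suc (Suc D)" .
  moreover have "(real k * r + 1 / r) * r ^ Suc D = r ^ D + real k * r ^ Suc (Suc D)"
    using assms by (simp add: field_simps)
  ultimately show ?thesis
    unfolding q_def[symmetric] using Suc by (simp add: radial_laplace_def distrib_left)
qed

text \<open>At \<eta> = 0 the left-hand side equals D + K + 2 and has derivative (K - 1) w - (D - 1)
  u < 0, so a small positive \<eta> works, as in a Chernoff bound.\<close>

lemma exp_drift:
  fixes D K u w :: real
  assumes "(K - 1) * w < (D - 1) * u"
  shows "\<exists>\<eta>>0. D * exp (- \<eta> * u) + exp (\<eta> * u) + (K * exp (\<eta> * w) + exp (- \<eta> * w)) \<le> D + K + 2"
proof -
  define F where "F \<eta> = D * exp (- \<eta> * u) + exp (\<eta> * u) + (K * exp (\<eta> * w) + exp (- \<eta> * w))" for \<eta>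
  have "(F has_real_derivative (- D * u + u + (K * w - w))) (at 0)"
    unfolding F_def by (auto intro!: derivative_eq_intros)
  moreover have "- D * u + u + (K * w - w) < 0" using assms by (simp add: algebra_simps)
  ultimately obtain e where e: "e > 0" "\<And>h. 0 < h \<Longrightarrow> h < e \<Longrightarrow> F (0 + h) < F 0"
    using DERIV_neg_dec_right by blast
  have "F (e / 2) \<le> F 0" using e(2)[of "e / 2"] e(1) by simp
  then show ?thesis using e(1) by (intro exI[of _ "e / 2"]) (simp add: F_def)
qed

text \<open>Under simple random walk \<open>i\<close> and \<open>j\<close> have drifts proportional
  to d - 1 and k - 1 off the axes, so by assumption w j - u i tends to decrease and a small
  exponential of it is superharmonic there. The correction at the root of the second tree makes the
  value at the origin 2. The lemma is applied with the two trees in either order.\<close>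

lemma radial_superharmonic:
  fixes u w :: real
  assumes "d \<ge> 1" "k \<ge> 1" "0 \<le> u" "(real k - 1) * w < (real d - 1) * u"
  shows "\<exists>\<eta> g h \<alpha> \<beta>. 0 < \<eta> \<and> (\<forall>i. radial_laplace d g i \<le> \<alpha> * g i) \<and>
    (\<forall>j. radial_laplace k h j \<le> \<beta> * h j) \<and> \<alpha> + \<beta> \<le> real d + real k + 2 \<and>
    (\<forall>i. 0 < g i) \<and> (\<forall>j. 0 < h j) \<and> g 0 * h 0 = 2 \<and>
    (\<forall>i j. exp (\<eta> * (w * real j - u * real i)) \<le> g i * h j)"
proof -
  obtain \<eta> where \<eta>: "\<eta> > 0"
    "real d * exp (- \<eta> * u) + exp (\<eta> * u) + (real k * exp (\<eta> * w) + exp (- \<eta> * w)) \<le> real d + real k + 2"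
    using exp_drift[OF assms(4)] by blast
  define s where "s = exp (- \<eta> * u)"
  define r where "r = exp (\<eta> * w)"
  define g where "g i = s ^ i" for i
  define h where "h j = r ^ j + (1 / (real k * r)) ^ j" for j
  have s: "0 < s" "s \<le> 1" "1 / s = exp (\<eta> * u)"
    using assms \<eta> by (auto simp: s_def exp_minus field_simps)
  have r: "0 < r" "1 / r = exp (- \<eta> * w)"
    by (auto simp: r_def exp_minus field_simps)
  have "exp (\<eta> * (w * real j - u * real i)) \<le> g i * h j" for i j
  proof -
    have "exp (\<eta> * (w * real j - u * real i)) = exp (real i * (- \<eta> * u) + real j * (\<eta> * w))"
      by (simp add: algebra_simps)
    also have "\<dots> = s ^ i * r ^ j"
      by (simp only: exp_add exp_of_nat_mult s_def r_def)
    also have "\<dots> \<le> g i * h j"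
      using s r by (auto simp: g_def h_def)
    finally show ?thesis .
  qed
  moreover have "radial_laplace d g i \<le> (real d * s + 1 / s) * g i" for i
    unfolding g_def using s by (intro radial_laplace_decay)
  moreover have "radial_laplace k h j \<le> (real k * r + 1 / r) * h j" for j
    unfolding h_def using r assms by (intro radial_laplace_growth)
  moreover have "(real d * s + 1 / s) + (real k * r + 1 / r) \<le> real d + real k + 2"
    using \<eta>(2) unfolding s(3) r(2) by (simp add: s_def r_def)
  moreover have "\<forall>i. 0 < g i" "\<forall>j. 0 < h j" "g 0 * h 0 = 2"
    using s r assms by (auto simp: g_def h_def add_pos_nonneg)
  ultimately show ?thesis using \<eta>(1) by blast
qed

section \<open>The product graph: neighbourhoods, averages and distances\<close>

locale tree_product = S: reg_tree S d + T: reg_tree T k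
  for S :: "'a \<Rightarrow> 'a \<Rightarrow> bool" and d and T :: "'b \<Rightarrow> 'b \<Rightarrow> bool" and k +
  assumes k1: "1 \<le> k" and kd: "k \<le> d" and dk3: "3 \<le> d + k"
begin

abbreviation "G \<equiv> cart_prod S T"

lemma d1: "1 \<le> d" using k1 kd by simp

lemma nbrs_G: "nbrs G (x, y) = (\<lambda>x'. (x', y)) ` nbrs S x \<union> Pair x ` nbrs T y"
  by (auto simp: nbrs_def cart_prod_def)

lemma sum_nbrs_G:
  "(\<Sum>z\<in>nbrs G (x, y). f z) = (\<Sum>x'\<in>nbrs S x. f (x', y)) + (\<Sum>y'\<in>nbrs T y. f (x, y'))"
  unfolding nbrs_G
proof (subst sum.union_disjoint)
  show "(\<lambda>x'. (x', y)) ` nbrs S x \<inter> Pair x ` nbrs T y = {}"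
    using S.irreflD by (auto simp: nbrs_def)
  show "sum f ((\<lambda>x'. (x', y)) ` nbrs S x) + sum f (Pair x ` nbrs T y) =
      (\<Sum>x'\<in>nbrs S x. f (x', y)) + (\<Sum>y'\<in>nbrs T y. f (x, y'))"
    by (simp add: sum.reindex inj_on_def)
qed (use S.fin_nbrs T.fin_nbrs in auto)

lemma card_nbrs_G: "card (nbrs G v) = d + k + 2"
  using sum_nbrs_G[of "\<lambda>_. 1::nat" "fst v" "snd v"] S.card_nbrs T.card_nbrs by simp

lemma finite_nbrs_G: "finite (nbrs G v)"
  using card_nbrs_G[of v] by (metis add_is_0 card.infinite zero_neq_numeral)

lemma nbrs_G_nonempty: "nbrs G v \<noteq> {}"
  using card_nbrs_G[of v] by (metis add_is_0 card.empty zero_neq_numeral)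

lemma avg_G: "avg G f v = (\<Sum>z\<in>nbrs G v. f z) / (real d + real k + 2)"
  by (simp add: avg_def card_nbrs_G)

lemma avg_mono:
  assumes "\<And>z. z \<in> nbrs G v \<Longrightarrow> f z \<le> g z"
  shows "avg G f v \<le> avg G g v"
  unfolding avg_G using assms by (intro divide_right_mono sum_mono) auto

lemma avg_const: "avg G (\<lambda>_. c) v = c"
  using nbrs_G_nonempty finite_nbrs_G by (auto simp: avg_def card_eq_0_iff)

lemma avg_add: "avg G (\<lambda>z. f z + g z) v = avg G f v + avg G g v"
  by (simp add: avg_def sum.distrib add_divide_distrib)

lemma avg_cmult: "avg G (\<lambda>z. c * f z) v = c * avg G f v"
  by (simp add: avg_def sum_distrib_left)

lemma avg_sum: "avg G (\<lambda>z. \<Sum>b\<in>B. f b z) v = (\<Sum>b\<in>B. avg G (f b) v)"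
  by (simp add: avg_def sum.swap[of _ B] sum_divide_distrib)

text \<open>Each neighbour changes one coordinate only, so the sum of a product function over the
  neighbours splits into two parts, bounded by \<alpha> and \<beta> times its value; the degree is d
  + k + 2.\<close>

lemma avg_radial:
  assumes "\<And>i. radial_laplace d g i \<le> \<alpha> * g i" "\<And>j. radial_laplace k h j \<le> \<beta> * h j"
    and "\<alpha> + \<beta> \<le> real d + real k + 2" "\<And>i. 0 \<le> g i" "\<And>j. 0 \<le> h j"
  shows "avg G (\<lambda>(x, y). g (graph_dist S x a) * h (graph_dist T y b)) v
    \<le> (\<lambda>(x, y). g (graph_dist S x a) * h (graph_dist T y b)) v"
proof -
  obtain x y where v: "v = (x, y)" by (cases v)
  let ?i = "graph_dist S x a" and ?j = "graph_dist T y b"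
  have "(\<Sum>z\<in>nbrs G v. (\<lambda>(x, y). g (graph_dist S x a) * h (graph_dist T y b)) z)
      = radial_laplace d g ?i * h ?j + g ?i * radial_laplace k h ?j"
    unfolding v sum_nbrs_G radial_laplace_def S.sum_nbrs_dist[symmetric] T.sum_nbrs_dist[symmetric]
    by (simp add: sum_distrib_left sum_distrib_right)
  also have "\<dots> \<le> \<alpha> * g ?i * h ?j + g ?i * (\<beta> * h ?j)"
    using assms by (intro add_mono mult_left_mono mult_right_mono) auto
  also have "\<dots> = (\<alpha> + \<beta>) * (g ?i * h ?j)" by (simp add: algebra_simps)
  also have "\<dots> \<le> (real d + real k + 2) * (g ?i * h ?j)"
    using assms by (intro mult_right_mono) auto
  finally show ?thesis unfolding avg_G by (simp add: v field_simps)
qed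

lemma relpowp_G:
  "(G ^^ t) (x, y) (x', y') \<Longrightarrow> \<exists>i j. i + j = t \<and> (S ^^ i) x x' \<and> (T ^^ j) y y'"
proof (induction t arbitrary: x' y')
  case (Suc t)
  then obtain w where w: "(G ^^ t) (x, y) w" "G w (x', y')" by auto
  obtain p q where pq: "w = (p, q)" by (cases w)
  obtain i j where ij: "i + j = t" "(S ^^ i) x p" "(T ^^ j) y q"
    using Suc.IH w(1) pq by blast
  from w(2) consider "S p x'" "q = y'" | "p = x'" "T q y'" by (auto simp: pq cart_prod_def)
  then show ?case
  proof cases
    case 1
    then show ?thesis using ij by (intro exI[of _ "Suc i"] exI[of _ j]) auto
  next
    case 2
    then show ?thesis using ij by (intro exI[of _ i] exI[of _ "Suc j"]) auto
  qed
qed auto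

lemma relpowp_G_left: "(S ^^ i) x x' \<Longrightarrow> (G ^^ i) (x, y) (x', y)"
proof (induction i arbitrary: x')
  case (Suc i)
  then obtain w where "(S ^^ i) x w" "S w x'" by auto
  then show ?case using Suc.IH[of w] relpowp_Suc_I[of i G "(x, y)" "(w, y)" "(x', y)"]
    by (simp add: cart_prod_def)
qed simp

lemma relpowp_G_right: "(T ^^ j) y y' \<Longrightarrow> (G ^^ j) (x, y) (x, y')"
proof (induction j arbitrary: y')
  case (Suc j)
  then obtain w where "(T ^^ j) y w" "T w y'" by auto
  then show ?case using Suc.IH[of w] relpowp_Suc_I[of j G "(x, y)" "(x, w)" "(x, y')"]
    by (simp add: cart_prod_def)
qed simp

lemma dist_G: "graph_dist G (x, y) (x', y') = graph_dist S x x' + graph_dist T y y'"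
  unfolding graph_dist_def[of G]
proof (rule Least_equality)
  show "(G ^^ (graph_dist S x x' + graph_dist T y y')) (x, y) (x', y')"
    using relpowp_G_left[OF S.dist_walk, of x x' y] relpowp_G_right[OF T.dist_walk, of y y' x']
    unfolding relpowp_add by blast
  show "graph_dist S x x' + graph_dist T y y' \<le> t" if "(G ^^ t) (x, y) (x', y')" for t
    using relpowp_G[OF that] S.dist_le T.dist_le add_mono by blast
qed

lemma dist_G_nbr:
  assumes "z \<in> nbrs G v"
  shows "graph_dist G z r \<le> Suc (graph_dist G v r)"
proof -
  obtain x y a b where "v = (x, y)" "r = (a, b)" by (cases v; cases r)
  then show ?thesis
    using assms S.dist_step[of _ x a] T.dist_step[of _ y b]
    by (auto simp: nbrs_G dist_G) (auto simp: nbrs_def)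
qed

lemma avg_dist: "avg G (\<lambda>z. real (graph_dist G z r)) v
  \<ge> real (graph_dist G v r) + (real d + real k - 2) / (real d + real k + 2)"
proof -
  obtain x y a b where v: "v = (x, y)" "r = (a, b)" by (cases v; cases r)
  let ?i = "graph_dist S x a" and ?j = "graph_dist T y b"
  \<comment> \<open>Equality for positive \<open>i\<close>: of e + 1 neighbours, e lie one step
    farther and one lies one step nearer. At the root all lie farther.\<close>
  have *: "radial_laplace e real i \<ge> (real e + 1) * real i + real e - 1" for e i
    by (cases i) (auto simp: radial_laplace_def algebra_simps)
  have "(\<Sum>z\<in>nbrs G v. real (graph_dist G z r)) = radial_laplace d real ?i + (real d + 1) * real ?j
      + ((real k + 1) * real ?i + radial_laplace k real ?j)"
    unfolding v sum_nbrs_G radial_laplace_def S.sum_nbrs_dist[symmetric] T.sum_nbrs_dist[symmetric]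
    by (simp add: dist_G sum.distrib S.card_nbrs T.card_nbrs algebra_simps)
  also have "\<dots> \<ge> (real d + real k + 2) * real (graph_dist G v r) + (real d + real k - 2)"
    using *[of d ?i] *[of k ?j] by (simp add: v dist_G algebra_simps)
  finally have "(\<Sum>z\<in>nbrs G v. real (graph_dist G z r)) / (real d + real k + 2) \<ge>
      ((real d + real k + 2) * real (graph_dist G v r) + (real d + real k - 2)) / (real d + real k + 2)"
    by (intro divide_right_mono) auto
  also have "((real d + real k + 2) * real (graph_dist G v r) + (real d + real k - 2)) / (real d + real k + 2)
     = real (graph_dist G v r) + (real d + real k - 2) / (real d + real k + 2)"
    by (simp add: add_divide_distrib)
  finally show ?thesis by (simp add: avg_G)
qed

end

subsection \<open>Bounds for the toppling number\<close>

context tree_product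
begin

text \<open>The share of the first factor in the speed of simple random walk.\<close>

definition share :: real where
  "share = (real d - 1) / (real d + real k - 2)"

text \<open>The number of vertices at distances \<open>i\<close>, \<open>j\<close> grows like exp (i
  ln d + j ln k) = exp ((i + j) ln k + i \<open>gap\<close>). For fixed i + j it is therefore
  governed by \<open>i\<close> alone.\<close>

definition gap :: real where
  "gap = ln (real d) - ln (real k)"

lemma dk_pos: "0 < real d + real k - 2"
  using dk3 by linarith

lemma share_bounds: "0 \<le> share" "share \<le> 1"
  using d1 k1 dk_pos by (auto simp: share_def field_simps)

text \<open>With u = 1 - \<open>share\<close> and w = \<open>share\<close> the drift condition of
  \<open>radial_superharmonic\<close> is an equality; both bounds below shift u and w by \<epsilon>
  to make it strict.\<close>

lemma share_drift: "(real k - 1) * share = (real d - 1) * (1 - share)"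
  using dk_pos by (simp add: share_def field_simps)

lemma gap_nonneg: "0 \<le> gap"
  using kd k1 by (simp add: gap_def)

lemma ln_theta: "ln (theta d k) = ln (real k) + share * gap"
proof -
  have "1 - share = (real k - 1) / (real d + real k - 2)"
    using dk_pos by (simp add: share_def field_simps)
  then have "ln (theta d k) = share * ln (real d) + (1 - share) * ln (real k)"
    using k1 d1 by (simp add: theta_def ln_mult share_def[symmetric] ln_powr)
  then show ?thesis by (simp add: gap_def algebra_simps)
qed

text \<open>Allows division by ln \<theta> when the error term is extracted. For k = 1 positivity
  comes from d being at least 2.\<close>

lemma ln_theta_pos: "0 < ln (theta d k)"
proof (cases "k = 1")
  case True
  then have "share = 1" "gap = ln (real d)" "1 < real d" using dk3 unfolding share_def gap_def by auto
  then show ?thesis unfolding ln_theta using k1 by (simp add: add_nonneg_pos)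
next
  case False
  then have "0 < ln (real k)" using k1 by simp
  then show ?thesis using share_bounds gap_nonneg by (simp add: ln_theta add_pos_nonneg)
qed

lemma mem_ball: "v \<in> graph_ball G \<rho> n \<longleftrightarrow> graph_dist G v \<rho> < n"
  by (simp add: graph_ball_def)

lemma dist_G_split: "graph_dist G v \<rho> = graph_dist S (fst v) (fst \<rho>) + graph_dist T (snd v) (snd \<rho>)"
  using dist_G[of "fst v" "snd v" "fst \<rho>" "snd \<rho>"] by simp

text \<open>The test function is built from Green functions of the toppled vertices on the sphere of
  radius \<open>m\<close> with large \<open>i\<close>, plus a small multiple of a radial exponential
  that takes care of those with small \<open>i\<close>. The two summands of the bound are their
  values at the origin, and \<eta> is chosen before \<open>m\<close> and \<open>t\<close>.\<close>

lemma topple_number_lower: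
  assumes "0 < \<epsilon>"
  shows "\<exists>\<eta>>0. \<forall>m t. topple_number p G (graph_ball G \<rho> (Suc m)) (point_mass \<rho>) = enat t \<longrightarrow>
    p \<le> 2 * exp (- \<eta> * \<epsilon> * real m) + real t * exp (- real m * (ln (theta d k) - 2 * \<epsilon> * gap))"
proof -
  define x\<^sub>0 y\<^sub>0 where "x\<^sub>0 = fst \<rho>" and "y\<^sub>0 = snd \<rho>"
  have \<rho>: "\<rho> = (x\<^sub>0, y\<^sub>0)" by (simp add: x\<^sub>0_def y\<^sub>0_def)
  \<comment> \<open>As u + w = 1, the exponent w j - u i equals (\<open>share\<close> - \<epsilon>)
    m - i on the sphere i + j = m. It is at least \<epsilon> m as soon as i <= (\<open>share\<close>
    - 2 \<epsilon>) m.\<close>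
  define u w where "u = 1 - share + \<epsilon>" and "w = share - \<epsilon>"
  have "(real d - 1) * u - (real k - 1) * w = \<epsilon> * (real d + real k - 2)"
    using share_drift by (simp add: u_def w_def algebra_simps)
  also have "0 < \<dots>" using assms dk_pos by simp
  finally have "(real k - 1) * w < (real d - 1) * u" by simp
  moreover have "0 \<le> u" using share_bounds assms by (simp add: u_def)
  ultimately obtain \<eta> g h \<alpha> \<beta> where gh: "0 < \<eta>"
    "\<And>i. radial_laplace d g i \<le> \<alpha> * g i" "\<And>j. radial_laplace k h j \<le> \<beta> * h j"
    "\<alpha> + \<beta> \<le> real d + real k + 2" "\<And>i. 0 < g i" "\<And>j. 0 < h j" "g 0 * h 0 = 2"
    "\<And>i j. exp (\<eta> * (w * real j - u * real i)) \<le> g i * h j"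
    using radial_superharmonic[OF d1 k1, of u w] by blast
  define f\<^sub>1 where "f\<^sub>1 = (\<lambda>(x, y). g (graph_dist S x x\<^sub>0) * h (graph_dist T y y\<^sub>0))"
  have f\<^sub>1: "avg G f\<^sub>1 v \<le> f\<^sub>1 v" "0 \<le> f\<^sub>1 v" for v
  proof -
    show "avg G f\<^sub>1 v \<le> f\<^sub>1 v"
      unfolding f\<^sub>1_def using gh by (intro avg_radial[where \<alpha> = \<alpha> and \<beta> = \<beta>]) (auto intro: less_imp_le)
    show "0 \<le> f\<^sub>1 v"
      using gh(5,6) by (simp add: f\<^sub>1_def case_prod_beta less_imp_le)
  qed
  define green where "green = (\<lambda>(a, b) (x, y).
    (1 / real d) ^ graph_dist S x a * (1 / real k) ^ graph_dist T y b)"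
  have green: "avg G (green a) v \<le> green a v" "0 \<le> green a v" "green a a = 1" for a v
  proof -
    show "avg G (green a) v \<le> green a v"
      unfolding green_def case_prod_beta[of _ a]
      by (rule avg_radial[OF radial_laplace_green[OF d1] radial_laplace_green[OF k1]]) auto
  qed (auto simp: green_def case_prod_beta)
  show ?thesis
  proof (intro exI[of _ \<eta>] conjI allI impI gh(1))
    fix m t
    assume "topple_number p G (graph_ball G \<rho> (Suc m)) (point_mass \<rho>) = enat t"
    from topple_number_superharmonic[OF finite_nbrs_G this]
    obtain B where B: "finite B" "card B \<le> t" and *:
      "\<forall>f. (\<forall>v\<in>B. avg G f v \<le> f v) \<longrightarrow> (\<forall>v. 0 \<le> f v) \<longrightarrow>
        (\<forall>v. v \<notin> graph_ball G \<rho> (Suc m) \<longrightarrow> 1 \<le> f v) \<longrightarrow> p \<le> f \<rho>"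
      by (elim exE conjE)
    note bound = *[rule_format]
    define P where "P = {v \<in> B. graph_dist G v \<rho> = m \<and>
      (share - 2 * \<epsilon>) * real m < real (graph_dist S (fst v) x\<^sub>0)}"
    define c where "c = exp (- \<eta> * \<epsilon> * real m)"
    define q where "q v = c * f\<^sub>1 v + (\<Sum>a\<in>P. green a v)" for v
    have P: "finite P" "card P \<le> t"
      using B card_mono[of B P] by (auto simp: P_def)
    have q: "avg G q v \<le> q v" "0 \<le> q v" for v
    proof -
      have "avg G q v = c * avg G f\<^sub>1 v + (\<Sum>a\<in>P. avg G (green a) v)"
        unfolding q_def by (simp only: avg_add avg_cmult avg_sum)
      also have "\<dots> \<le> q v"
        unfolding q_def using f\<^sub>1 green by (intro add_mono mult_left_mono sum_mono) (auto simp: c_def)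
      finally show "avg G q v \<le> q v" .
      show "0 \<le> q v"
        unfolding q_def using f\<^sub>1 green by (intro add_nonneg_nonneg mult_nonneg_nonneg sum_nonneg) (auto simp: c_def)
    qed
    have q1: "1 \<le> q v" if "v \<in> B" "graph_dist G v \<rho> = m" for v
    proof (cases "v \<in> P")
      case True
      then have "green v v \<le> (\<Sum>a\<in>P. green a v)"
        using P green by (intro member_le_sum[of v P "\<lambda>a. green a v"]) auto
      moreover have "0 \<le> c * f\<^sub>1 v" using f\<^sub>1 by (simp add: c_def)
      ultimately show ?thesis using green(3)[of v] by (simp add: q_def)
    next
      case False
      define i j where "i = graph_dist S (fst v) x\<^sub>0" and "j = graph_dist T (snd v) y\<^sub>0"
      have "m = i + j" using that by (simp add: dist_G_split i_def j_def \<rho>)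
      then have m: "real m = real i + real j" by simp
      have "real i \<le> (share - 2 * \<epsilon>) * real m"
        using False that by (auto simp: P_def i_def)
      also have "w * real j - u * real i = (share - \<epsilon>) * real m - real i"
        unfolding m by (simp add: u_def w_def algebra_simps)
      ultimately have "\<epsilon> * real m \<le> w * real j - u * real i" by (simp add: algebra_simps)
      then have "\<eta> * (\<epsilon> * real m) \<le> \<eta> * (w * real j - u * real i)"
        using gh(1) by (intro mult_left_mono) auto
      then have "exp (\<eta> * (\<epsilon> * real m)) \<le> exp (\<eta> * (w * real j - u * real i))" by simp
      also have "\<dots> \<le> f\<^sub>1 v"
        using gh(8)[of j i] by (simp add: f\<^sub>1_def case_prod_beta i_def j_def)
      finally have "c * exp (\<eta> * (\<epsilon> * real m)) \<le> c * f\<^sub>1 v"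
        by (intro mult_left_mono) (auto simp: c_def)
      moreover have "c * exp (\<eta> * (\<epsilon> * real m)) = 1"
        by (simp add: c_def exp_add[symmetric])
      moreover have "0 \<le> (\<Sum>a\<in>P. green a v)" using green by (intro sum_nonneg)
      ultimately show ?thesis by (simp add: q_def)
    qed
    \<comment> \<open>Where \<open>v\<close> is at distance less than \<open>m\<close>, all
      neighbours are within distance \<open>m\<close> and \<open>f\<close> lies below
      \<open>q\<close> there, so \<open>f\<close> inherits superharmonicity from \<open>q\<close>
      and 1. At toppled vertices farther out \<open>f\<close> takes its maximal value 1, by
      \<open>q1\<close> on the sphere itself.\<close>
    define f where "f v = (if graph_dist G v \<rho> \<le> m then min 1 (q v) else 1)" for v
    have "p \<le> f \<rho>"
    proof (rule bound)
      have f_le: "f v \<le> 1" for v by (simp add: f_def)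
      have avg1: "avg G f v \<le> 1" for v
        using avg_mono[of v f "\<lambda>_. 1"] f_le avg_const[of 1 v] by simp
      show "avg G f v \<le> f v" if "v \<in> B" for v
      proof (cases "graph_dist G v \<rho> < m")
        case True
        have "f z \<le> q z" if "z \<in> nbrs G v" for z
          using dist_G_nbr[OF that, of \<rho>] True by (simp add: f_def)
        then have "avg G f v \<le> avg G q v" by (rule avg_mono)
        then have "avg G f v \<le> q v" using q(1)[of v] by simp
        then show ?thesis using avg1[of v] True by (simp add: f_def)
      next
        case False
        then have "f v = 1" using q1[OF \<open>v \<in> B\<close>] by (auto simp: f_def)
        then show ?thesis using avg1 by simp
      qed
    qed (use q in \<open>auto simp: f_def mem_ball\<close>)
    also have "f \<rho> \<le> q \<rho>" by (simp add: f_def dist_G_split)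
    also have "\<dots> \<le> c * 2 + (\<Sum>a\<in>P. exp (- real m * (ln (theta d k) - 2 * \<epsilon> * gap)))"
    proof -
      have "f\<^sub>1 \<rho> = 2" using gh(7) by (simp add: f\<^sub>1_def \<rho>)
      moreover have "green a \<rho> \<le> exp (- real m * (ln (theta d k) - 2 * \<epsilon> * gap))" if "a \<in> P" for a
      proof -
        define i j where "i = graph_dist S (fst a) x\<^sub>0" and "j = graph_dist T (snd a) y\<^sub>0"
        have "m = i + j" using that by (simp add: P_def dist_G_split i_def j_def \<rho>)
        then have m: "real m = real i + real j" by simp
        \<comment> \<open>Since \<open>gap\<close> is nonnegative, a lower bound on \<open>i\<close>
          gives one on i ln d + j ln k = m ln k + i \<open>gap\<close>.\<close>
        have "(share - 2 * \<epsilon>) * real m * gap \<le> real i * gap"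
          using that gap_nonneg by (intro mult_right_mono) (auto simp: P_def i_def)
        then have "real m * (ln (theta d k) - 2 * \<epsilon> * gap) \<le> real i * ln (real d) + real j * ln (real k)"
          unfolding ln_theta by (simp add: m gap_def algebra_simps)
        then have "exp (real i * - ln (real d) + real j * - ln (real k))
            \<le> exp (- real m * (ln (theta d k) - 2 * \<epsilon> * gap))" by simp
        moreover have "exp (real i * - ln (real d) + real j * - ln (real k)) = green a \<rho>"
          using d1 k1 unfolding exp_add exp_of_nat_mult exp_minus
          by (simp add: green_def case_prod_beta \<rho> i_def j_def S.dist_commute[of x\<^sub>0]
              T.dist_commute[of y\<^sub>0] field_simps)
        ultimately show ?thesis by (simp only:)
      qed
      ultimately show ?thesis unfolding q_def by (intro add_mono sum_mono) auto
    qed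
    also have "(\<Sum>a\<in>P. exp (- real m * (ln (theta d k) - 2 * \<epsilon> * gap)))
        \<le> real t * exp (- real m * (ln (theta d k) - 2 * \<epsilon> * gap))"
      using P by simp
    finally show "p \<le> 2 * exp (- \<eta> * \<epsilon> * real m)
        + real t * exp (- real m * (ln (theta d k) - 2 * \<epsilon> * gap))"
      by (simp add: c_def mult.commute)
  qed
qed

section \<open>Upper bound, finiteness and positivity of the toppling number\<close>

definition drift :: real where
  "drift = (real d + real k - 2) / (real d + real k + 2)"

lemma drift_pos: "0 < drift"
  using dk_pos by (auto simp: drift_def)

text \<open>The budget of \<open>topple_rounds\<close> is the remaining distance to the boundary of
  the ball: it is \<open>n\<close> at the origin, and each unit of mass toppled inside the ball
  lowers it by at least \<open>drift\<close>.\<close>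

lemma topple_number_le_ball:
  assumes W: "finite W" "W \<subseteq> graph_ball G \<rho> n"
    and f: "\<And>v. 0 \<le> f v" "\<And>v. v \<in> W \<Longrightarrow> avg G f v \<le> f v"
      "\<And>v. v \<in> graph_ball G \<rho> n \<Longrightarrow> v \<notin> W \<Longrightarrow> 1 \<le> f v"
    and c: "0 \<le> c" "real n \<le> drift * c * real t" "c + f \<rho> \<le> 1 - p"
  shows "topple_number p G (graph_ball G \<rho> n) (point_mass \<rho>) \<le> enat (t * card W)"
proof (rule topple_number_le[where g = "\<lambda>v. max 0 (real n - real (graph_dist G v \<rho>))" and l = drift,
      OF finite_nbrs_G nbrs_G_nonempty W(1) _ drift_pos _ f c(1) _ c(3)])
  show "max 0 (real n - real (graph_dist G \<rho> \<rho>)) \<le> drift * c * real t"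
    using c by (simp add: dist_G_split)
  fix v assume "v \<in> W"
  then have v: "graph_dist G v \<rho> < n" using W(2) by (auto simp: mem_ball)
  have "avg G (\<lambda>v. max 0 (real n - real (graph_dist G v \<rho>))) v
      \<le> avg G (\<lambda>v. real n + (- 1) * real (graph_dist G v \<rho>)) v"
  proof (rule avg_mono)
    fix z assume "z \<in> nbrs G v"
    \<comment> \<open>A neighbour of a vertex of the open ball is at distance at most
      \<open>n\<close>, so the truncation at 0 has no effect.\<close>
    from dist_G_nbr[OF this, of \<rho>] v have "graph_dist G z \<rho> \<le> n" by simp
    then show "max 0 (real n - real (graph_dist G z \<rho>)) \<le> real n + (- 1) * real (graph_dist G z \<rho>)"
      by simp
  qed
  also have "\<dots> = real n - avg G (\<lambda>v. real (graph_dist G v \<rho>)) v"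
    by (simp only: avg_add avg_cmult avg_const)
  also have "\<dots> \<le> max 0 (real n - real (graph_dist G v \<rho>)) - drift"
    using avg_dist[of v \<rho>] v by (simp add: drift_def)
  finally show "avg G (\<lambda>v. max 0 (real n - real (graph_dist G v \<rho>))) v
      \<le> max 0 (real n - real (graph_dist G v \<rho>)) - drift" .
qed auto

lemma ball_decomp:
  "{v \<in> graph_ball G \<rho> n. Q (graph_dist S (fst v) (fst \<rho>))} =
    (\<Union>(i, j)\<in>{(i, j). i + j < n \<and> Q i}. {x. graph_dist S x (fst \<rho>) = i} \<times> {y. graph_dist T y (snd \<rho>) = j})"
  by (auto simp: mem_ball dist_G_split)

lemma finite_pairs: "finite {(i, j). i + j < (n::nat) \<and> Q i}"
  by (rule finite_subset[of _ "{..<n} \<times> {..<n}"]) auto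

lemma finite_ball_part: "finite {v \<in> graph_ball G \<rho> n. Q (graph_dist S (fst v) (fst \<rho>))}"
  unfolding ball_decomp using finite_pairs[of n Q] S.finite_card_sphere[OF d1] T.finite_card_sphere[OF k1]
  by auto

lemma topple_number_finite:
  assumes "p < 1"
  shows "\<exists>t. topple_number p G (graph_ball G \<rho> n) (point_mass \<rho>) = enat t"
proof -
  have "finite (graph_ball G \<rho> n)" using finite_ball_part[of \<rho> n "\<lambda>_. True"] by simp
  moreover obtain t where "real n < real t * (drift * (1 - p))"
    using drift_pos assms by (metis reals_Archimedean3 diff_gt_0_iff_gt mult_pos_pos)
  ultimately have "topple_number p G (graph_ball G \<rho> n) (point_mass \<rho>) \<le> enat (t * card (graph_ball G \<rho> n))"
    \<comment> \<open>The whole ball is toppled, so nothing has to be estimated by \<open>f\<close>,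
      and mass 1 - p may stay behind.\<close>
    using assms avg_const[of 0]
    by (intro topple_number_le_ball[where f = "\<lambda>_. 0" and c = "1 - p"]) (auto simp: mult_ac)
  then show ?thesis by (metis enat_ile)
qed

text \<open>Without moves the set \<open>B\<close> is empty, so every function is superharmonic on
  it; the indicator of the complement of the ball vanishes at the origin. Positivity is needed for
  taking logarithms.\<close>

lemma topple_number_pos:
  assumes "0 < p" "0 < n"
  shows "topple_number p G (graph_ball G \<rho> n) (point_mass \<rho>) \<noteq> 0"
proof
  assume "topple_number p G (graph_ball G \<rho> n) (point_mass \<rho>) = 0"
  then have "topple_number p G (graph_ball G \<rho> n) (point_mass \<rho>) = enat 0"
    by (simp add: zero_enat_def)
  from topple_number_superharmonic[OF finite_nbrs_G this]
  obtain B where B: "finite B" "card B \<le> 0" and *: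
    "\<forall>f. (\<forall>v\<in>B. avg G f v \<le> f v) \<longrightarrow> (\<forall>v. 0 \<le> f v) \<longrightarrow>
      (\<forall>v. v \<notin> graph_ball G \<rho> n \<longrightarrow> 1 \<le> f v) \<longrightarrow> p \<le> f \<rho>"
    by (elim exE conjE)
  have "p \<le> indicator (- graph_ball G \<rho> n) \<rho>" using B by (intro *[rule_format]) auto
  then show False using assms by (simp add: mem_ball dist_G_split)
qed

text \<open>At most n^2 pairs of distances occur, and each contributes a product of two spheres
  whose exponent i \<open>gap\<close> + (i + j) ln k is largest at the ends of both ranges.\<close>

lemma card_ball_part:
  assumes "0 \<le> \<gamma>"
  shows "real (card {v \<in> graph_ball G \<rho> n. real (graph_dist S (fst v) (fst \<rho>)) \<le> \<gamma>})
    \<le> real n ^ 2 * (real ((d + 1) * (k + 1)) * exp (\<gamma> * gap + real n * ln (real k)))"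
proof -
  let ?P = "{(i, j). i + j < n \<and> real i \<le> \<gamma>}"
  let ?C = "\<lambda>(i, j). {x. graph_dist S x (fst \<rho>) = i} \<times> {y. graph_dist T y (snd \<rho>) = j}"
  have "real (card (?C (i, j))) \<le> real ((d + 1) * (k + 1)) * exp (\<gamma> * gap + real n * ln (real k))"
    if "(i, j) \<in> ?P" for i j
  proof -
    have "card (?C (i, j)) \<le> ((d + 1) * d ^ i) * ((k + 1) * k ^ j)"
      using S.finite_card_sphere[OF d1] T.finite_card_sphere[OF k1]
      by (simp add: card_cartesian_product mult_mono)
    then have "real (card (?C (i, j))) \<le> real (((d + 1) * d ^ i) * ((k + 1) * k ^ j))"
      by (rule of_nat_mono)
    also have "\<dots> = real ((d + 1) * (k + 1)) * exp (real i * ln (real d) + real j * ln (real k))"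
      using d1 k1 unfolding exp_add exp_of_nat_mult by (simp add: algebra_simps)
    also have "real i * ln (real d) + real j * ln (real k) = real i * gap + real (i + j) * ln (real k)"
      by (simp add: gap_def algebra_simps)
    also have "real ((d + 1) * (k + 1)) * exp (real i * gap + real (i + j) * ln (real k))
        \<le> real ((d + 1) * (k + 1)) * exp (\<gamma> * gap + real n * ln (real k))"
      using that gap_nonneg k1
      by (intro mult_left_mono exp_le_cancel_iff[THEN iffD2] add_mono mult_right_mono) auto
    finally show ?thesis .
  qed
  then have "(\<Sum>ij\<in>?P. real (card (?C ij)))
      \<le> real (card ?P) * (real ((d + 1) * (k + 1)) * exp (\<gamma> * gap + real n * ln (real k)))"
    by (intro sum_bounded_above) auto
  moreover have "card ?P \<le> card ({..<n} \<times> {..<n})"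
    by (intro card_mono) auto
  then have "real (card ?P) \<le> real n ^ 2"
    by (simp add: power2_eq_square flip: of_nat_mult)
  moreover have "card (\<Union>ij\<in>?P. ?C ij) \<le> (\<Sum>ij\<in>?P. card (?C ij))"
    by (intro card_UN_le finite_pairs)
  then have "real (card (\<Union>ij\<in>?P. ?C ij)) \<le> (\<Sum>ij\<in>?P. real (card (?C ij)))"
    by (simp flip: of_nat_sum)
  ultimately show ?thesis
    unfolding ball_decomp[of _ _ "\<lambda>i. real i \<le> \<gamma>"]
    by (smt (verit) exp_gt_zero mult_nonneg_nonneg mult_right_mono of_nat_0_le_iff)
qed

text \<open>Only vertices of the ball with \<open>i\<close> at most (\<open>share\<close> + 2
  \<epsilon>) n are toppled. The mass that reaches larger \<open>i\<close> inside the ball is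
  bounded by a radial exponential, now growing in the first coordinate and decaying in the
  second.\<close>

lemma topple_number_upper:
  assumes "0 < \<epsilon>"
  shows "\<exists>\<eta>>0. \<forall>n t c s. 0 \<le> c \<longrightarrow> real n \<le> drift * c * real t \<longrightarrow>
    c + 2 * exp (- \<eta> * \<epsilon> * real n) \<le> 1 - p \<longrightarrow>
    topple_number p G (graph_ball G \<rho> n) (point_mass \<rho>) = enat s \<longrightarrow>
    real s \<le> real t * (real n ^ 2 * (real ((d + 1) * (k + 1)) * exp (real n * (ln (theta d k) + 2 * \<epsilon> * gap))))"
proof -
  define x\<^sub>0 y\<^sub>0 where "x\<^sub>0 = fst \<rho>" and "y\<^sub>0 = snd \<rho>"
  have \<rho>: "\<rho> = (x\<^sub>0, y\<^sub>0)" by (simp add: x\<^sub>0_def y\<^sub>0_def)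
  define u w where "u = share + \<epsilon>" and "w = 1 - share - \<epsilon>"
  have "(real k - 1) * u - (real d - 1) * w = \<epsilon> * (real d + real k - 2)"
    using share_drift by (simp add: u_def w_def algebra_simps)
  also have "0 < \<dots>" using assms dk_pos by simp
  finally have "(real d - 1) * w < (real k - 1) * u" by simp
  moreover have u: "0 \<le> u" using share_bounds assms by (simp add: u_def)
  ultimately obtain \<eta> g h \<alpha> \<beta> where gh: "0 < \<eta>"
    "\<And>i. radial_laplace k g i \<le> \<alpha> * g i" "\<And>j. radial_laplace d h j \<le> \<beta> * h j"
    "\<alpha> + \<beta> \<le> real k + real d + 2" "\<And>i. 0 < g i" "\<And>j. 0 < h j" "g 0 * h 0 = 2"
    "\<And>i j. exp (\<eta> * (w * real j - u * real i)) \<le> g i * h j"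
    using radial_superharmonic[OF k1 d1, of u w] by blast
  define f\<^sub>1 where "f\<^sub>1 = (\<lambda>(x, y). h (graph_dist S x x\<^sub>0) * g (graph_dist T y y\<^sub>0))"
  have f\<^sub>1: "avg G f\<^sub>1 v \<le> f\<^sub>1 v" "0 \<le> f\<^sub>1 v" for v
  proof -
    show "avg G f\<^sub>1 v \<le> f\<^sub>1 v"
      unfolding f\<^sub>1_def using gh by (intro avg_radial[where \<alpha> = \<beta> and \<beta> = \<alpha>]) (auto intro: less_imp_le)
    show "0 \<le> f\<^sub>1 v"
      using gh(5,6) by (simp add: f\<^sub>1_def case_prod_beta less_imp_le)
  qed
  show ?thesis
  proof (intro exI[of _ \<eta>] conjI allI impI gh(1))
    fix n t c s
    assume c: "0 \<le> c" "real n \<le> drift * c * real t" "c + 2 * exp (- \<eta> * \<epsilon> * real n) \<le> 1 - p"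
      and s: "topple_number p G (graph_ball G \<rho> n) (point_mass \<rho>) = enat s"
    define W where "W = {v \<in> graph_ball G \<rho> n. real (graph_dist S (fst v) (fst \<rho>)) \<le> (share + 2 * \<epsilon>) * real n}"
    define b where "b = exp (- \<eta> * \<epsilon> * real n)"
    have "topple_number p G (graph_ball G \<rho> n) (point_mass \<rho>) \<le> enat (t * card W)"
    proof (rule topple_number_le_ball[where f = "\<lambda>v. b * f\<^sub>1 v" and c = c])
      show "finite W" unfolding W_def by (rule finite_ball_part)
      show "W \<subseteq> graph_ball G \<rho> n" by (auto simp: W_def)
      show "0 \<le> b * f\<^sub>1 v" for v using f\<^sub>1 by (simp add: b_def)
      show "avg G (\<lambda>v. b * f\<^sub>1 v) v \<le> b * f\<^sub>1 v" for v
        unfolding avg_cmult using f\<^sub>1 by (intro mult_left_mono) (auto simp: b_def)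
      show "c + b * f\<^sub>1 \<rho> \<le> 1 - p"
        using c(3) gh(7) by (simp add: f\<^sub>1_def \<rho> b_def mult.commute)
    next
      fix v assume v: "v \<in> graph_ball G \<rho> n" "v \<notin> W"
      define i j where "i = graph_dist S (fst v) x\<^sub>0" and "j = graph_dist T (snd v) y\<^sub>0"
      have "i + j < n" using v by (simp add: mem_ball dist_G_split i_def j_def \<rho>)
      \<comment> \<open>As u + w = 1, the exponent w i - u j is i - u (i + j), which is at least i -
        (\<open>share\<close> + \<epsilon>) n inside the ball.\<close>
      then have "u * real j \<le> u * (real n - real i)" using u by (intro mult_left_mono) auto
      moreover have "(share + 2 * \<epsilon>) * real n < real i"
        using v by (auto simp: W_def i_def x\<^sub>0_def)
      ultimately have "\<epsilon> * real n \<le> w * real i - u * real j"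
        by (simp add: u_def w_def algebra_simps)
      then have "\<eta> * (\<epsilon> * real n) \<le> \<eta> * (w * real i - u * real j)"
        using gh(1) by (intro mult_left_mono) auto
      then have "exp (\<eta> * (\<epsilon> * real n)) \<le> exp (\<eta> * (w * real i - u * real j))" by simp
      also have "\<dots> \<le> f\<^sub>1 v"
        using gh(8)[of i j] by (simp add: f\<^sub>1_def case_prod_beta i_def j_def mult.commute)
      finally have "b * exp (\<eta> * (\<epsilon> * real n)) \<le> b * f\<^sub>1 v"
        by (intro mult_left_mono) (auto simp: b_def)
      moreover have "b * exp (\<eta> * (\<epsilon> * real n)) = 1"
        by (simp add: b_def exp_add[symmetric])
      ultimately show "1 \<le> b * f\<^sub>1 v" by simp
    qed (use c in auto)
    then have "real s \<le> real t * real (card W)"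
      unfolding s by (simp flip: of_nat_mult)
    also have "\<dots> \<le> real t * (real n ^ 2 * (real ((d + 1) * (k + 1)) *
        exp ((share + 2 * \<epsilon>) * real n * gap + real n * ln (real k))))"
      unfolding W_def using share_bounds assms by (intro mult_left_mono card_ball_part) auto
    also have "(share + 2 * \<epsilon>) * real n * gap + real n * ln (real k) = real n * (ln (theta d k) + 2 * \<epsilon> * gap)"
      unfolding ln_theta by (simp add: algebra_simps)
    finally show "real s \<le> real t * (real n ^ 2 * (real ((d + 1) * (k + 1)) *
        exp (real n * (ln (theta d k) + 2 * \<epsilon> * gap))))" .
  qed
qed

end

subsection \<open>Uniqueness of the regular trees\<close>

locale graph_iso =
  fixes \<phi> :: "'a \<Rightarrow> 'b" and E E'
  assumes bij: "bij \<phi>" and adj: "E' (\<phi> u) (\<phi> v) \<longleftrightarrow> E u v"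
begin

lemma inv_iso: "graph_iso (inv \<phi>) E' E"
proof
  show "bij (inv \<phi>)" using bij by (rule bij_imp_bij_inv)
  show "E (inv \<phi> u) (inv \<phi> v) \<longleftrightarrow> E' u v" for u v
    using adj[of "inv \<phi> u" "inv \<phi> v"] bij by (simp add: bij_is_surj surj_f_inv_f)
qed

lemma inv_simps [simp]: "\<phi> (inv \<phi> y) = y" "inv \<phi> (\<phi> x) = x"
  using bij by (simp_all add: bij_is_surj surj_f_inv_f bij_is_inj inv_f_f)

lemma relpowp_image: "(E ^^ t) u v \<Longrightarrow> (E' ^^ t) (\<phi> u) (\<phi> v)"
proof (induction t arbitrary: v)
  case (Suc t)
  then obtain w where "(E ^^ t) u w" "E w v" by auto
  then show ?case using Suc.IH[of w] adj[of w v] by auto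
qed simp

lemma nbrs_image: "nbrs E' (\<phi> v) = \<phi> ` nbrs E v"
proof
  show "nbrs E' (\<phi> v) \<subseteq> \<phi> ` nbrs E v"
  proof
    fix y assume "y \<in> nbrs E' (\<phi> v)"
    then show "y \<in> \<phi> ` nbrs E v"
      using adj[of "inv \<phi> y" v] by (intro image_eqI[of _ _ "inv \<phi> y"]) (auto simp: nbrs_def)
  qed
qed (auto simp: nbrs_def adj)

lemma point_mass_image: "point_mass (\<phi> v) (\<phi> x) = point_mass v x"
  using bij by (auto simp: point_mass_def indicator_def bij_is_inj inj_eq)

lemma topple_image: "topple E' (\<phi> v) m (\<mu> \<circ> inv \<phi>) = topple E v m \<mu> \<circ> inv \<phi>"
proof
  fix y
  have "(\<Sum>z\<in>nbrs E' (\<phi> v). point_mass z y) = (\<Sum>z\<in>nbrs E v. point_mass (\<phi> z) y)"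
    unfolding nbrs_image using bij by (subst sum.reindex) (auto intro: inj_on_subset bij_is_inj)
  also have "\<dots> = (\<Sum>z\<in>nbrs E v. point_mass z (inv \<phi> y))"
    using point_mass_image[of _ "inv \<phi> y"] by simp
  moreover have "card (nbrs E' (\<phi> v)) = card (nbrs E v)"
    unfolding nbrs_image using bij by (intro card_image) (auto intro: inj_on_subset bij_is_inj)
  ultimately show "topple E' (\<phi> v) m (\<mu> \<circ> inv \<phi>) y = (topple E v m \<mu> \<circ> inv \<phi>) y"
    using point_mass_image[of v "inv \<phi> y"] by (simp add: topple_def)
qed

lemma topple_steps_image:
  "(topple_step E ^^ t) \<mu> \<nu> \<Longrightarrow> (topple_step E' ^^ t) (\<mu> \<circ> inv \<phi>) (\<nu> \<circ> inv \<phi>)"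
proof (induction t arbitrary: \<nu>)
  case (Suc t)
  then obtain \<kappa> where \<kappa>: "(topple_step E ^^ t) \<mu> \<kappa>" "topple_step E \<kappa> \<nu>" by auto
  then obtain v m where "0 < \<kappa> v" "0 < m" "m \<le> \<kappa> v" "\<nu> = topple E v m \<kappa>"
    by (auto simp: topple_step_def)
  then have "topple_step E' (\<kappa> \<circ> inv \<phi>) (\<nu> \<circ> inv \<phi>)"
    unfolding topple_step_def by (intro exI[of _ "\<phi> v"] exI[of _ m]) (simp add: topple_image)
  then show ?case using Suc.IH[OF \<kappa>(1)] by (rule relpowp_Suc_I[rotated])
qed simp

lemma mass_outside_image: "mass_outside (\<phi> ` A) (\<mu> \<circ> inv \<phi>) = mass_outside A \<mu>"
proof -
  have "- \<phi> ` A = \<phi> ` (- A)" using bij by (simp add: bij_image_Compl_eq)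
  then have "mass_outside (\<phi> ` A) (\<mu> \<circ> inv \<phi>) = (\<Sum>\<^sub>\<infinity>y\<in>\<phi> ` (- A). ennreal ((\<mu> \<circ> inv \<phi>) y))"
    by (simp add: mass_outside_def)
  also have "\<dots> = (\<Sum>\<^sub>\<infinity>x\<in>- A. ennreal (\<mu> x))"
    using bij by (subst infsum_reindex) (auto intro: inj_on_subset bij_is_inj simp: o_def)
  finally show ?thesis by (simp add: mass_outside_def)
qed

lemma topple_number_image_le:
  "topple_number p E' (\<phi> ` A) (\<mu> \<circ> inv \<phi>) \<le> topple_number p E A \<mu>"
  unfolding topple_number_def
proof (rule Inf_superset_mono, safe)
  fix t \<nu> assume "(topple_step E ^^ t) \<mu> \<nu>" "ennreal p \<le> mass_outside A \<nu>"
  then show "\<exists>t'. enat t = enat t' \<and> (\<exists>\<nu>. (topple_step E' ^^ t') (\<mu> \<circ> inv \<phi>) \<nu> \<and>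
      ennreal p \<le> mass_outside (\<phi> ` A) \<nu>)"
    using topple_steps_image mass_outside_image by metis
qed

lemma point_mass_image': "point_mass (\<phi> v) = point_mass v \<circ> inv \<phi>"
  using point_mass_image[of v "inv \<phi> _"] by (auto simp: fun_eq_iff)

lemma topple_number_ball:
  "topple_number p E' (graph_ball E' (\<phi> \<rho>) n) (point_mass (\<phi> \<rho>))
    = topple_number p E (graph_ball E \<rho> n) (point_mass \<rho>)"
proof (rule antisym)
  \<comment> \<open>Transport along \<phi> gives one inequality, transport along its inverse the
    other.\<close>
  interpret inv: graph_iso "inv \<phi>" E' E by (rule inv_iso)
  have "(E' ^^ t) (\<phi> u) (\<phi> v) \<longleftrightarrow> (E ^^ t) u v" for t u v
    using relpowp_image[of t u v] inv.relpowp_image[of t "\<phi> u" "\<phi> v"] by auto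
  then have dist: "graph_dist E' (\<phi> u) (\<phi> v) = graph_dist E u v" for u v
    by (simp add: graph_dist_def)
  have ball: "graph_ball E' (\<phi> \<rho>) n = \<phi> ` graph_ball E \<rho> n"
  proof
    show "graph_ball E' (\<phi> \<rho>) n \<subseteq> \<phi> ` graph_ball E \<rho> n"
    proof
      fix y assume "y \<in> graph_ball E' (\<phi> \<rho>) n"
      then show "y \<in> \<phi> ` graph_ball E \<rho> n"
        using dist[of "inv \<phi> y" \<rho>] by (intro image_eqI[of _ _ "inv \<phi> y"]) (auto simp: graph_ball_def)
    qed
  qed (auto simp: graph_ball_def dist)
  show "topple_number p E' (graph_ball E' (\<phi> \<rho>) n) (point_mass (\<phi> \<rho>))
      \<le> topple_number p E (graph_ball E \<rho> n) (point_mass \<rho>)"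
    unfolding ball point_mass_image' by (rule topple_number_image_le)
  have "inv \<phi> ` \<phi> ` graph_ball E \<rho> n = graph_ball E \<rho> n"
    by (simp add: image_image)
  moreover have "point_mass (\<phi> \<rho>) \<circ> inv (inv \<phi>) = point_mass \<rho>"
    using bij by (simp add: inv_inv_eq fun_eq_iff point_mass_image)
  ultimately show "topple_number p E (graph_ball E \<rho> n) (point_mass \<rho>)
      \<le> topple_number p E' (graph_ball E' (\<phi> \<rho>) n) (point_mass (\<phi> \<rho>))"
    using inv.topple_number_image_le[of p "\<phi> ` graph_ball E \<rho> n" "point_mass (\<phi> \<rho>)"]
    unfolding ball by simp
qed

end

lemma graph_iso_cart_prod:
  assumes "graph_iso \<phi> S S'" "graph_iso \<psi> T T'"
  shows "graph_iso (map_prod \<phi> \<psi>) (cart_prod S T) (cart_prod S' T')"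
proof -
  interpret S: graph_iso \<phi> S S' by fact
  interpret T: graph_iso \<psi> T T' by fact
  show ?thesis
  proof
    show "bij (map_prod \<phi> \<psi>)"
      using S.bij T.bij by (simp add: bij_def map_prod_surj prod.inj_map)
    show "cart_prod S' T' (map_prod \<phi> \<psi> u) (map_prod \<phi> \<psi> v) = cart_prod S T u v" for u v
      using S.bij T.bij
      by (auto simp: cart_prod_def case_prod_beta map_prod_def S.adj T.adj bij_is_inj inj_eq)
  qed
qed

text \<open>A vertex of the rooted tree \<open>\<T>\<^sub>d\<close> is coded by the list of the child numbers on the path
  to it, the last step first.\<close>

fun codeword :: "nat \<Rightarrow> nat list \<Rightarrow> bool" where
  "codeword d [] \<longleftrightarrow> True"
| "codeword d (i # w) \<longleftrightarrow> codeword d w \<and> i < (if w = [] then d + 1 else d)"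

context reg_tree
begin

definition children :: "'a \<Rightarrow> 'a \<Rightarrow> 'a set" where
  "children r x = {y \<in> nbrs E x. graph_dist E y r = Suc (graph_dist E x r)}"

lemma finite_children: "finite (children r x)"
  using fin_nbrs by (simp add: children_def)

lemma card_children: "card (children r x) = (if x = r then d + 1 else d)"
proof (cases "graph_dist E x r")
  case 0
  then have "children r x = nbrs E x" using nbrs_root by (auto simp: children_def)
  then show ?thesis using 0 card_nbrs by simp
next
  case (Suc D)
  then obtain y where y: "y \<in> nbrs E x" "graph_dist E y r = D"
    "\<And>z. z \<in> nbrs E x - {y} \<Longrightarrow> graph_dist E z r = Suc (Suc D)" using nbrs_split by blast
  then have "children r x = nbrs E x - {y}" using Suc by (auto simp: children_def)
  moreover have "x \<noteq> r" using Suc by auto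
  ultimately show ?thesis using y card_nbrs fin_nbrs by (simp add: card_Diff_singleton)
qed

definition child :: "'a \<Rightarrow> 'a \<Rightarrow> nat \<Rightarrow> 'a" where
  "child r x = (SOME h. bij_betw h {0..<card (children r x)} (children r x))"

lemma bij_child: "bij_betw (child r x) {0..<card (children r x)} (children r x)"
  unfolding child_def using ex_bij_betw_nat_finite[OF finite_children] by (rule someI_ex)

primrec decode :: "'a \<Rightarrow> nat list \<Rightarrow> 'a" where
  "decode r [] = r"
| "decode r (i # w) = child r (decode r w) i"

text \<open>Both claims need a joint induction: the number of children depends on whether the
  decoded vertex is the root, and this is read off from its distance.\<close>

lemma decode_child:
  "codeword d w \<Longrightarrow> graph_dist E (decode r w) r = length w \<and>
    (w \<noteq> [] \<longrightarrow> decode r w \<in> children r (decode r (tl w)))"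
proof (induction w)
  case (Cons i w)
  then have "graph_dist E (decode r w) r = length w" by simp
  then have "decode r w = r \<longleftrightarrow> w = []" by (metis dist_eq_0_iff length_0_conv)
  then have "i < card (children r (decode r w))" using Cons.prems by (simp add: card_children)
  then have "child r (decode r w) i \<in> children r (decode r w)"
    using bij_child[of r "decode r w"] by (auto dest: bij_betwE)
  then show ?case using Cons by (simp add: children_def)
qed simp

lemma card_children_decode:
  assumes "codeword d w"
  shows "card (children r (decode r w)) = (if w = [] then d + 1 else d)"
  using decode_child[OF assms, of r] by (metis card_children dist_eq_0_iff length_0_conv)

lemma children_unique: "y \<in> children r x \<Longrightarrow> y \<in> children r x' \<Longrightarrow> x = x'"
  using unique_parent[of y x x' r] by (auto simp: children_def nbrs_def)

text \<open>The distance determines the length of the word, the unique parent its tail, and the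
  enumeration of the children its head.\<close>

lemma inj_decode: "inj_on (decode r) {w. codeword d w}"
proof (rule inj_onI, clarify)
  show "codeword d w \<Longrightarrow> codeword d w' \<Longrightarrow> decode r w = decode r w' \<Longrightarrow> w = w'" for w w'
  proof (induction w arbitrary: w')
    case Nil
    then show ?case using decode_child[of "[]" r] decode_child[of w' r] by simp
  next
    case (Cons i w)
    have "length w' = Suc (length w)"
      using decode_child[OF Cons.prems(1), of r] decode_child[OF Cons.prems(2), of r] Cons.prems(3) by simp
    then obtain j v where w': "w' = j # v" by (cases w') auto
    have "decode r w = decode r v"
      using decode_child[OF Cons.prems(1), of r] decode_child[OF Cons.prems(2), of r] Cons.prems(3)
      by (auto simp: w' intro: children_unique)
    then have wv: "w = v" using Cons.IH[of v] Cons.prems by (simp add: w')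
    have "i < card (children r (decode r w))" "j < card (children r (decode r w))"
      using Cons.prems card_children_decode[of w r] by (simp_all add: w' wv)
    then have "i = j"
      using bij_child[of r "decode r w"] Cons.prems(3) by (auto simp: w' wv bij_betw_def inj_on_def)
    then show ?case by (simp add: w' wv)
  qed
qed

lemma decode_children:
  assumes "codeword d w" "y \<in> children r (decode r w)"
  obtains i where "codeword d (i # w)" "decode r (i # w) = y"
proof -
  have "y \<in> child r (decode r w) ` {0..<card (children r (decode r w))}"
    using bij_child[of r "decode r w"] assms(2) by (simp add: bij_betw_def)
  then obtain i where "i < card (children r (decode r w))" "child r (decode r w) i = y"
    by auto
  then show ?thesis using that[of i] assms(1) card_children_decode[of w r] by simp
qed

lemma decode_surj: "\<exists>w. codeword d w \<and> decode r w = y"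
proof (induction "graph_dist E y r" arbitrary: y)
  case 0
  then show ?case by (intro exI[of _ "[]"]) simp
next
  case (Suc D)
  then obtain x where x: "E y x" "graph_dist E x r = D" by (metis dist_parent)
  then obtain w where w: "codeword d w" "decode r w = x" using Suc.hyps(1) by blast
  have "y \<in> children r (decode r w)" using x w Suc.hyps(2) by (simp add: children_def nbrs_def)
  then show ?case using decode_children[OF w(1)] by metis
qed

lemma bij_decode: "bij_betw (decode r) {w. codeword d w} UNIV"
  unfolding bij_betw_def using inj_decode decode_surj[of r] by (metis UNIV_eq_I imageI mem_Collect_eq)

text \<open>Adjacent vertices never have equal distance from \<open>r\<close>, so every edge joins a
  parent to a child.\<close>

lemma adj_children: "E x y \<longleftrightarrow> x \<in> children r y \<or> y \<in> children r x"
proof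
  assume xy: "E x y"
  have "graph_dist E x r = Suc (graph_dist E y r) \<or> graph_dist E y r = Suc (graph_dist E x r)"
  proof (cases "graph_dist E y r")
    case 0
    then show ?thesis using nbrs_root[of x r] xy by (auto simp: nbrs_def)
  next
    case (Suc D)
    then show ?thesis using nbrs_split[OF Suc] xy by (metis DiffI mem_Collect_eq nbrs_def singletonD)
  qed
  then show "x \<in> children r y \<or> y \<in> children r x"
    using xy symD by (auto simp: children_def nbrs_def)
qed (auto simp: children_def nbrs_def dest: symD)

lemma decode_in_children_iff:
  assumes "codeword d w" "codeword d w'"
  shows "decode r w' \<in> children r (decode r w) \<longleftrightarrow> (\<exists>i. w' = i # w)"
proof
  assume "decode r w' \<in> children r (decode r w)"
  then obtain i where "codeword d (i # w)" "decode r (i # w) = decode r w'"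
    using decode_children[OF assms(1)] by metis
  then have "i # w = w'" using inj_decode[of r] assms(2) by (metis inj_onD mem_Collect_eq)
  then show "\<exists>i. w' = i # w" by blast
next
  assume "\<exists>i. w' = i # w"
  then show "decode r w' \<in> children r (decode r w)" using decode_child[OF assms(2), of r] by auto
qed

lemma adj_decode:
  assumes "codeword d w" "codeword d w'"
  shows "E (decode r w) (decode r w') \<longleftrightarrow> (\<exists>i. w' = i # w) \<or> (\<exists>i. w = i # w')"
  using adj_children[of "decode r w" "decode r w'" r] decode_in_children_iff assms by blast

end

text \<open>Codewords and their adjacency depend on \<open>d\<close> only, so coding in one tree and
  decoding in the other is an isomorphism. The empty word carries one prescribed root to the
  other.\<close>

lemma reg_tree_iso:
  assumes "reg_tree E d" "reg_tree E' d"
  shows "\<exists>\<phi>. graph_iso \<phi> E E' \<and> \<phi> r = r'"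
proof -
  interpret E: reg_tree E d by fact
  interpret E': reg_tree E' d by fact
  let ?C = "{w. codeword d w}"
  define code where "code = inv_into ?C (E.decode r)"
  have code: "codeword d (code x)" "E.decode r (code x) = x" for x
    using inv_into_into[of x "E.decode r" ?C] f_inv_into_f[of x "E.decode r" ?C] E.bij_decode[of r]
    by (auto simp: code_def bij_betw_def)
  have "bij_betw code UNIV ?C"
    unfolding code_def using E.bij_decode by (rule bij_betw_inv_into)
  then have "bij (E'.decode r' \<circ> code)"
    using E'.bij_decode by (rule bij_betw_trans)
  moreover have "E' ((E'.decode r' \<circ> code) u) ((E'.decode r' \<circ> code) v) \<longleftrightarrow> E u v" for u v
    using E'.adj_decode[of "code u" "code v" r'] E.adj_decode[of "code u" "code v" r] code by simp
  ultimately have "graph_iso (E'.decode r' \<circ> code) E E'" by unfold_locales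
  moreover have "code r = []"
    using code[of r] E.inj_decode[of r] by (auto dest!: inj_onD[of _ _ "code r" "[]"])
  ultimately show ?thesis by (intro exI[of _ "E'.decode r' \<circ> code"]) simp
qed

text \<open>Makes the error term independent of the copies of the trees and of the origin.\<close>

lemma topple_number_unique:
  assumes "regular_tree d S" "regular_tree k T" "regular_tree d S'" "regular_tree k T'"
  shows "topple_number p (cart_prod S T) (graph_ball (cart_prod S T) \<rho> n) (point_mass \<rho>)
    = topple_number p (cart_prod S' T') (graph_ball (cart_prod S' T') \<rho>' n) (point_mass \<rho>')"
proof -
  obtain \<phi> where \<phi>: "graph_iso \<phi> S S'" "\<phi> (fst \<rho>) = fst \<rho>'"
    using reg_tree_iso assms(1,3) unfolding reg_tree_iff by metis
  obtain \<psi> where \<psi>: "graph_iso \<psi> T T'" "\<psi> (snd \<rho>) = snd \<rho>'"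
    using reg_tree_iso assms(2,4) unfolding reg_tree_iff by metis
  have "map_prod \<phi> \<psi> \<rho> = \<rho>'" using \<phi>(2) \<psi>(2) by (cases \<rho>; cases \<rho>') simp
  then show ?thesis
    using graph_iso.topple_number_ball[OF graph_iso_cart_prod[OF \<phi>(1) \<psi>(1)], of p \<rho> n] by simp
qed

subsection \<open>Exponential growth rate\<close>

lemma exp_decay_eventually:
  fixes a c :: real
  assumes "0 < a" "0 < c"
  shows "eventually (\<lambda>n. 2 * exp (- a * real n) \<le> c) sequentially"
proof -
  have "(\<lambda>n. 2 * exp (- a) ^ n) \<longlonglongrightarrow> 2 * 0"
    using assms by (intro tendsto_intros LIMSEQ_realpow_zero) auto
  then have "eventually (\<lambda>n. 2 * exp (- a) ^ n < c) sequentially"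
    using assms by (intro order_tendstoD) auto
  then show ?thesis
    by eventually_elim (simp add: exp_of_nat_mult[symmetric] mult.commute)
qed

context tree_product
begin

lemma topple_number_growth:
  assumes p: "0 < p" "p < 1"
  shows "(\<lambda>n. ln (real (the_enat (topple_number p G (graph_ball G \<rho> n) (point_mass \<rho>)))) / real n)
    \<longlonglongrightarrow> ln (theta d k)"
proof -
  define N where "N n = the_enat (topple_number p G (graph_ball G \<rho> n) (point_mass \<rho>))" for n
  define L where "L = ln (theta d k)"
  have N: "topple_number p G (graph_ball G \<rho> n) (point_mass \<rho>) = enat (N n)" for n
    using topple_number_finite[OF p(2), of \<rho> n] by (auto simp: N_def)
  have N_pos: "0 < N n" if "0 < n" for n
    using topple_number_pos[OF p(1) that, of \<rho>] unfolding N by (simp add: zero_enat_def)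
  have "(\<lambda>n. ln (real (N n)) / real n) \<longlonglongrightarrow> L"
  proof (rule order_tendstoI)
    fix y assume "y < L"
    \<comment> \<open>This keeps 2 \<epsilon> \<open>gap\<close> below L - y; the summand 1 avoids a
      division by zero when d = k.\<close>
    define \<epsilon> where "\<epsilon> = (L - y) / (4 * (gap + 1))"
    have \<epsilon>: "0 < \<epsilon>" using \<open>y < L\<close> gap_nonneg by (simp add: \<epsilon>_def)
    have "4 * (\<epsilon> * (gap + 1)) = L - y" using gap_nonneg by (simp add: \<epsilon>_def field_simps)
    then have y: "y < L - 2 * \<epsilon> * gap"
      using \<epsilon> mult_nonneg_nonneg[OF less_imp_le[OF \<epsilon>] gap_nonneg] by (simp add: algebra_simps)
    obtain \<eta> where \<eta>: "0 < \<eta>" "\<And>m. p \<le> 2 * exp (- \<eta> * \<epsilon> * real m)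
        + real (N (Suc m)) * exp (- real m * (L - 2 * \<epsilon> * gap))"
      using topple_number_lower[OF \<epsilon>, of p \<rho>] N unfolding L_def by blast
    let ?z = "L - 2 * \<epsilon> * gap"
    have "eventually (\<lambda>m. 2 * exp (- (\<eta> * \<epsilon>) * real m) \<le> p / 2) sequentially"
      using \<eta>(1) \<epsilon> p by (intro exp_decay_eventually) auto
    then have "eventually (\<lambda>m. (ln (p / 2) - ?z) / real (Suc m) + ?z \<le> ln (real (N (Suc m))) / real (Suc m))
        sequentially"
    proof eventually_elim
      case (elim m)
      then have "p / 2 \<le> real (N (Suc m)) * exp (- real m * ?z)" using \<eta>(2)[of m] by simp
      then have "ln (p / 2) \<le> ln (real (N (Suc m)) * exp (- real m * ?z))"
        using p N_pos[of "Suc m"] by (subst ln_le_cancel_iff) auto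
      also have "\<dots> = ln (real (N (Suc m))) - real m * ?z"
        using N_pos[of "Suc m"] by (simp add: ln_mult)
      \<comment> \<open>The sphere radius is \<open>m\<close> while the ball radius is m + 1, so one
        copy of \<open>?z\<close> moves into the constant.\<close>
      finally have "(ln (p / 2) - ?z + real (Suc m) * ?z) / real (Suc m) \<le> ln (real (N (Suc m))) / real (Suc m)"
        by (intro divide_right_mono) (auto simp: algebra_simps)
      then show ?case by (simp add: add_divide_distrib del: of_nat_Suc)
    qed
    then have ev: "eventually (\<lambda>n. (ln (p / 2) - ?z) / real n + ?z \<le> ln (real (N n)) / real n) sequentially"
      by (subst (asm) eventually_sequentially_Suc)
    have "(\<lambda>n. (ln (p / 2) - ?z) / real n + ?z) \<longlonglongrightarrow> 0 + ?z"
      by (intro tendsto_intros lim_const_over_n)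
    then have "eventually (\<lambda>n. y < (ln (p / 2) - ?z) / real n + ?z) sequentially"
      using y by (intro order_tendstoD) auto
    with ev show "eventually (\<lambda>n. y < ln (real (N n)) / real n) sequentially"
      by eventually_elim simp
  next
    fix y assume "L < y"
    define \<epsilon> where "\<epsilon> = (y - L) / (4 * (gap + 1))"
    have \<epsilon>: "0 < \<epsilon>" using \<open>L < y\<close> gap_nonneg by (simp add: \<epsilon>_def)
    have "4 * (\<epsilon> * (gap + 1)) = y - L" using gap_nonneg by (simp add: \<epsilon>_def field_simps)
    then have y: "L + 2 * \<epsilon> * gap < y"
      using \<epsilon> mult_nonneg_nonneg[OF less_imp_le[OF \<epsilon>] gap_nonneg] by (simp add: algebra_simps)
    \<comment> \<open>The permitted loss 1 - p is shared equally: mass left on the toppled set and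
      mass in the rest of the ball.\<close>
    define c where "c = (1 - p) / 2"
    have c: "0 < c" and cc: "c + c = 1 - p" using p by (simp_all add: c_def)
    obtain M where M: "1 < real M * (drift * c)"
      using drift_pos c by (metis reals_Archimedean3 mult_pos_pos)
    then have M0: "0 < M" by (cases M) auto
    let ?z = "L + 2 * \<epsilon> * gap"
    define K where "K = real M * real ((d + 1) * (k + 1))"
    have K: "0 < K" using M0 unfolding K_def by (intro mult_pos_pos) (simp_all del: of_nat_mult)
    obtain \<eta> where \<eta>: "0 < \<eta>" "\<And>n t. real n \<le> drift * c * real t \<Longrightarrow>
        c + 2 * exp (- \<eta> * \<epsilon> * real n) \<le> 1 - p \<Longrightarrow>
        real (N n) \<le> real t * (real n ^ 2 * (real ((d + 1) * (k + 1)) * exp (real n * ?z)))"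
      using topple_number_upper[OF \<epsilon>, of p \<rho>] N c less_imp_le unfolding L_def by metis
    have "eventually (\<lambda>n. 2 * exp (- (\<eta> * \<epsilon>) * real n) \<le> c) sequentially"
      using \<eta>(1) \<epsilon> c by (intro exp_decay_eventually) auto
    then have ev: "eventually (\<lambda>n. ln (real (N n)) / real n \<le> ln K / real n + 3 * (ln (real n) / real n) + ?z)
        sequentially"
      using eventually_gt_at_top[of 0]
    proof eventually_elim
      case (elim n)
      \<comment> \<open>n M rounds suffice, as M exceeds 1/(\<open>drift\<close> c). They give one
        factor n, and the number of distance pairs gives n^2.\<close>
      have "real n * 1 \<le> real n * (real M * (drift * c))" using M by (intro mult_left_mono) auto
      then have "real n \<le> drift * c * real (n * M)" by (simp add: mult_ac)
      then have "real (N n) \<le> real (n * M) * (real n ^ 2 * (real ((d + 1) * (k + 1)) * exp (real n * ?z)))"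
        using elim cc by (intro \<eta>(2)) auto
      also have "\<dots> = K * real n ^ 3 * exp (real n * ?z)"
        by (simp add: K_def power2_eq_square power3_eq_cube)
      finally have "ln (real (N n)) \<le> ln (K * real n ^ 3 * exp (real n * ?z))"
        using N_pos[of n] elim by (subst ln_le_cancel_iff) (auto intro: less_le_trans)
      also have "\<dots> = ln K + 3 * ln (real n) + real n * ?z"
        using elim K by (simp add: ln_mult ln_realpow)
      finally have "ln (real (N n)) / real n \<le> (ln K + 3 * ln (real n) + real n * ?z) / real n"
        by (intro divide_right_mono) auto
      then show ?case using elim by (simp add: add_divide_distrib)
    qed
    have "(\<lambda>n. ln K / real n + 3 * (ln (real n) / real n) + ?z) \<longlonglongrightarrow> 0 + 3 * 0 + ?z"
      by (intro tendsto_intros lim_const_over_n lim_ln_over_n)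
    then have "eventually (\<lambda>n. ln K / real n + 3 * (ln (real n) / real n) + ?z < y) sequentially"
      using y by (intro order_tendstoD) auto
    with ev show "eventually (\<lambda>n. ln (real (N n)) / real n < y) sequentially"
      by eventually_elim simp
  qed
  then show ?thesis by (simp add: N_def L_def)
qed

end

theorem theorem1p7:
  fixes d k :: nat and p :: real
  assumes "k \<ge> 1" and "d \<ge> k" and "d + k \<ge> 3" and "0 < p" and "p < 1"
  shows "\<exists>\<epsilon> :: nat \<Rightarrow> real. \<epsilon> \<longlonglongrightarrow> 0 \<and>
    (\<forall>(S :: 'a \<Rightarrow> 'a \<Rightarrow> bool) (T :: 'b \<Rightarrow> 'b \<Rightarrow> bool) (\<rho> :: 'a \<times> 'b).
       regular_tree d S \<longrightarrow> regular_tree k T \<longrightarrow>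
         (\<forall>n\<ge>1. ereal_of_enat
             (topple_number p (cart_prod S T) (graph_ball (cart_prod S T) \<rho> n) (point_mass \<rho>))
           = ereal (theta d k powr (real n * (1 + \<epsilon> n)))) \<and>
         (\<lambda>n. ln (real (the_enat
             (topple_number p (cart_prod S T) (graph_ball (cart_prod S T) \<rho> n) (point_mass \<rho>))))
           / real n) \<longlonglongrightarrow> ln (theta d k))"
proof (cases "\<exists>(S :: 'a \<Rightarrow> 'a \<Rightarrow> bool) (T :: 'b \<Rightarrow> 'b \<Rightarrow> bool). regular_tree d S \<and> regular_tree k T")
  \<comment> \<open>If the two types carry no such trees, the claim is vacuous and any null sequence
    will do.\<close>
  case False
  then show ?thesis by (intro exI[of _ "\<lambda>_. 0"]) auto
next
  case True
  then obtain S\<^sub>0 :: "'a \<Rightarrow> 'a \<Rightarrow> bool" and T\<^sub>0 :: "'b \<Rightarrow> 'b \<Rightarrow> bool"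
    where ST: "regular_tree d S\<^sub>0" "regular_tree k T\<^sub>0" by blast
  interpret tree_product S\<^sub>0 d T\<^sub>0 k
    using ST assms by (simp add: tree_product_def tree_product_axioms_def reg_tree_iff)
  define \<rho>\<^sub>0 :: "'a \<times> 'b" where "\<rho>\<^sub>0 = undefined"
  define N where "N n = the_enat (topple_number p G (graph_ball G \<rho>\<^sub>0 n) (point_mass \<rho>\<^sub>0))" for n
  have N: "topple_number p G (graph_ball G \<rho>\<^sub>0 n) (point_mass \<rho>\<^sub>0) = enat (N n)" for n
    using topple_number_finite[OF assms(5), of \<rho>\<^sub>0 n] by (auto simp: N_def)
  have N_pos: "0 < N n" if "0 < n" for n
    using topple_number_pos[OF assms(4) that, of \<rho>\<^sub>0] unfolding N by (simp add: zero_enat_def)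
  have lim: "(\<lambda>n. ln (real (N n)) / real n) \<longlonglongrightarrow> ln (theta d k)"
    using topple_number_growth[OF assms(4,5), of \<rho>\<^sub>0] by (simp add: N_def)
  \<comment> \<open>Obtained by solving \<theta>^(n (1 + \<epsilon>)) = N for \<epsilon>, so the
    formula is exact for n >= 1, and the limit of ln N / n makes \<epsilon> tend to 0.\<close>
  define \<epsilon> where "\<epsilon> n = ln (real (N n)) / real n / ln (theta d k) - 1" for n
  have "\<epsilon> \<longlonglongrightarrow> ln (theta d k) / ln (theta d k) - 1"
    unfolding \<epsilon>_def using lim ln_theta_pos by (intro tendsto_intros) auto
  then have \<epsilon>: "\<epsilon> \<longlonglongrightarrow> 0" using ln_theta_pos by simp
  have "theta d k \<noteq> 0" using ln_theta_pos by auto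
  then have powr: "theta d k powr (real n * (1 + \<epsilon> n)) = real (N n)" if "n \<ge> 1" for n
    using that N_pos[of n] ln_theta_pos by (simp add: powr_def \<epsilon>_def)
  show ?thesis
  proof (intro exI[of _ \<epsilon>] conjI allI impI \<epsilon>)
    fix S :: "'a \<Rightarrow> 'a \<Rightarrow> bool" and T :: "'b \<Rightarrow> 'b \<Rightarrow> bool" and \<rho> :: "'a \<times> 'b"
    assume "regular_tree d S" "regular_tree k T"
    then have eq: "topple_number p (cart_prod S T) (graph_ball (cart_prod S T) \<rho> n) (point_mass \<rho>)
        = enat (N n)" for n
      using topple_number_unique[OF _ _ ST, of S T p \<rho> n \<rho>\<^sub>0] N by simp
    show "ereal_of_enat
        (topple_number p (cart_prod S T) (graph_ball (cart_prod S T) \<rho> n) (point_mass \<rho>))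
        = ereal (theta d k powr (real n * (1 + \<epsilon> n)))" if "n \<ge> 1" for n
      unfolding eq powr[OF that] by simp
    show "(\<lambda>n. ln (real (the_enat
        (topple_number p (cart_prod S T) (graph_ball (cart_prod S T) \<rho> n) (point_mass \<rho>))))
        / real n) \<longlonglongrightarrow> ln (theta d k)"
      unfolding eq using lim by simp
  qed
qed

end
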